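(* Let $p$ and $q$ be monic polynomials with degree $2$ over $\mathbb{F}$, and assume that they are both irreducible with distinct splitting fields (in $\overline{\mathbb{F}}$) and the same non-zero discriminant. Set $r:=t^2+(\operatorname{tr}p)\,t+p(0)+q(0)$. Let $u$ be an endomorphism of a finite-dimensional vector space $V$ over $\mathbb{F}$. Then, the following conditions are equivalent: (i) The endomorphism $u$ is a d-exceptional $(p,q)$-difference. (ii) The minimal polynomial of $u$ is a power of $r$, and if we denote by $r_1,\dots,r_k,\dots$ the invariant factors of $u$, then $r_{2k-1}=r_{2k}$ for all $k\geq 1$. (iii) In some basis of $V$, the endomorphism $u$ is represented by a block-diagonal matrix in which each diagonal block equals $C(r^n)\oplus C(r^n)$ for some positive integer $n$.
   Context: $\mathbb{F}$ is an arbitrary field with algebraic closure $\overline{\mathbb{F}}$. For a monic polynomial $p$ of degree $n\ge 1$, $\operatorname{tr}(p)$ is the opposite of the coefficient of $p$ on $t^{n-1}$, and $\operatorname{Root}(p)$ is its set of roots in $\overline{\mathbb{F}}$. The discriminant of $p(t)=(t-x_1)(t-x_2)$ is $(x_1-x_2)^2$. An endomorphism $u$ of $V$ is a $(p,q)$-difference if $u=a-b$ for some endomorphisms $a,b$ of $V$ with $p(a)=0$ and $q(b)=0$. It is d-exceptional with respect to $(p,q)$ if all its eigenvalues in $\overline{\mathbb{F}}$ belong to $\operatorname{Root}(p)-\operatorname{Root}(q)=\{x-y: x\in\operatorname{Root}(p),\,y\in\operatorname{Root}(q)\}$; a d-exceptional $(p,q)$-difference is a $(p,q)$-difference that is d-exceptional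 with respect to $(p,q)$. $C(r)$ is the companion matrix of the monic polynomial $r$, and $\oplus$ is block-diagonal sum. The invariant factors of $u$ are the monic polynomials $r_1,r_2,\dots$ with $r_{i+1}\mid r_i$ such that $u$ is represented in some basis by $C(r_1)\oplus C(r_2)\oplus\cdots$ ($C(1)$ being the $0\times 0$ matrix); the finite list of nonconstant ones is extended to an infinite sequence by $r_i=1$. *)

theory Defs
  imports
    "HOL-Algebra.Algebraic_Closure_Type"
    "HOL-Algebra.Generated_Fields"
    "Jordan_Normal_Form.Matrix"
    "Jordan_Normal_Form.Char_Poly"
begin

text \<open>
  The algebraic closure of the field \<open>'a\<close> is the type \<open>'a alg_closure\<close>, with embedding
  \<^const>\<open>to_ac\<close>. A vector space over \<open>'a\<close> is a type \<open>'b\<close> with a scalar multiplication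
  satisfying the locale \<^locale>\<open>vector_space\<close>. The abbreviation \<open>monic\<close> says that the leading
  coefficient is 1.
\<close>

definition poly_trace :: "'a::field poly \<Rightarrow> 'a" where
  "poly_trace p = - coeff p (degree p - 1)"

definition Root :: "'a::field poly \<Rightarrow> 'a alg_closure set" where
  "Root p = {x. poly (map_poly to_ac p) x = 0}"

text \<open>
  Only meaningful for monic \<open>p\<close> of degree 2. It takes values in the algebraic closure, where
  the roots are.
\<close>

definition discr :: "'a::field poly \<Rightarrow> 'a alg_closure" where
  "discr p = (THE d. \<exists>x1 x2. map_poly to_ac p = [:- x1, 1:] * [:- x2, 1:] \<and> d = (x1 - x2)\<^sup>2)"

definition splitting_field :: "'a::field poly \<Rightarrow> 'a alg_closure set" where
  "splitting_field p = generate_field ring_of_type_algebra (range to_ac \<union> Root p)"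

text \<open>
  Ones below the diagonal, and the negated lower coefficients of \<open>r\<close> in the last column. For
  \<open>r = 1\<close> this is the empty \<open>0 \<times> 0\<close> matrix.
\<close>

definition companion_mat :: "'a::field poly \<Rightarrow> 'a mat" where
  "companion_mat r = mat (degree r) (degree r)
     (\<lambda>(i, j). if j = degree r - 1 then - coeff r i else if i = Suc j then 1 else 0)"

definition endo :: "('a::field \<Rightarrow> 'b::ab_group_add \<Rightarrow> 'b) \<Rightarrow> ('b \<Rightarrow> 'b) \<Rightarrow> bool" where
  "endo scale u \<longleftrightarrow> Vector_Spaces.linear scale scale u"

definition poly_endo :: "('a::field \<Rightarrow> 'b::ab_group_add \<Rightarrow> 'b) \<Rightarrow> 'a poly \<Rightarrow> ('b \<Rightarrow> 'b) \<Rightarrow> 'b \<Rightarrow> 'b" where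
  "poly_endo scale f u = (\<lambda>v. \<Sum>i\<le>degree f. scale (coeff f i) ((u ^^ i) v))"

definition annihilates :: "('a::field \<Rightarrow> 'b::ab_group_add \<Rightarrow> 'b) \<Rightarrow> 'a poly \<Rightarrow> ('b \<Rightarrow> 'b) \<Rightarrow> bool" where
  "annihilates scale f u \<longleftrightarrow> (\<forall>v. poly_endo scale f u v = 0)"

definition minimal_poly :: "('a::field \<Rightarrow> 'b::ab_group_add \<Rightarrow> 'b) \<Rightarrow> ('b \<Rightarrow> 'b) \<Rightarrow> 'a poly" where
  "minimal_poly scale u =
     (THE m. monic m \<and> annihilates scale m u \<and> (\<forall>f. annihilates scale f u \<longrightarrow> m dvd f))"

definition ordered_basis :: "('a::field \<Rightarrow> 'b::ab_group_add \<Rightarrow> 'b) \<Rightarrow> 'b list \<Rightarrow> bool" where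
  "ordered_basis scale bs \<longleftrightarrow>
     distinct bs \<and> \<not> module.dependent scale (set bs) \<and> module.span scale (set bs) = UNIV"

text \<open>Column \<open>j\<close> of \<open>M\<close> holds the coordinates of the image of the \<open>j\<close>-th basis vector.\<close>

definition represented_in :: "('a::field \<Rightarrow> 'b::ab_group_add \<Rightarrow> 'b) \<Rightarrow> 'b list \<Rightarrow> ('b \<Rightarrow> 'b) \<Rightarrow> 'a mat \<Rightarrow> bool" where
  "represented_in scale bs u M \<longleftrightarrow>
     ordered_basis scale bs \<and> M \<in> carrier_mat (length bs) (length bs) \<and>
     (\<forall>j<length bs. u (bs ! j) = (\<Sum>i<length bs. scale (M $$ (i, j)) (bs ! i)))"

definition represented_by :: "('a::field \<Rightarrow> 'b::ab_group_add \<Rightarrow> 'b) \<Rightarrow> ('b \<Rightarrow> 'b) \<Rightarrow> 'a mat \<Rightarrow> bool" where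
  "represented_by scale u M \<longleftrightarrow> (\<exists>bs. represented_in scale bs u M)"

definition pq_difference :: "('a::field \<Rightarrow> 'b::ab_group_add \<Rightarrow> 'b) \<Rightarrow> 'a poly \<Rightarrow> 'a poly \<Rightarrow> ('b \<Rightarrow> 'b) \<Rightarrow> bool" where
  "pq_difference scale p q u \<longleftrightarrow>
     (\<exists>a b. endo scale a \<and> endo scale b \<and> annihilates scale p a \<and> annihilates scale q b \<and>
        u = (\<lambda>v. a v - b v))"

text \<open>
  The eigenvalues of \<open>u\<close> in the algebraic closure are those of any matrix representing \<open>u\<close>,
  with entries mapped into the closure.
\<close>

definition ac_eigenvalue :: "('a::field \<Rightarrow> 'b::ab_group_add \<Rightarrow> 'b) \<Rightarrow> ('b \<Rightarrow> 'b) \<Rightarrow> 'a alg_closure \<Rightarrow> bool" where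
  "ac_eigenvalue scale u x \<longleftrightarrow> (\<exists>M. represented_by scale u M \<and> eigenvalue (map_mat to_ac M) x)"

definition d_exceptional :: "('a::field \<Rightarrow> 'b::ab_group_add \<Rightarrow> 'b) \<Rightarrow> 'a poly \<Rightarrow> 'a poly \<Rightarrow> ('b \<Rightarrow> 'b) \<Rightarrow> bool" where
  "d_exceptional scale p q u \<longleftrightarrow>
     (\<forall>z. ac_eigenvalue scale u z \<longrightarrow> z \<in> {x - y |x y. x \<in> Root p \<and> y \<in> Root q})"

definition is_invariant_factors :: "('a::field \<Rightarrow> 'b::ab_group_add \<Rightarrow> 'b) \<Rightarrow> ('b \<Rightarrow> 'b) \<Rightarrow> (nat \<Rightarrow> 'a poly) \<Rightarrow> bool" where
  "is_invariant_factors scale u rs \<longleftrightarrow>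
     (\<forall>i. monic (rs i)) \<and> (\<forall>i. rs (Suc i) dvd rs i) \<and>
     (\<exists>m. (\<forall>i\<ge>m. rs i = 1) \<and>
          represented_by scale u (diag_block_mat (map (\<lambda>i. companion_mat (rs i)) [0..<m])))"

text \<open>
  The sequences above start at index 0. The invariant factors themselves are numbered from 1,
  so that the value at 0 is not used.
\<close>

definition invariant_factor :: "('a::field \<Rightarrow> 'b::ab_group_add \<Rightarrow> 'b) \<Rightarrow> ('b \<Rightarrow> 'b) \<Rightarrow> nat \<Rightarrow> 'a poly" where
  "invariant_factor scale u k = (THE rs. is_invariant_factors scale u rs) (k - 1)"

end

theory Submission
  imports Defs
begin

text \<open>
  Equal discriminants and distinct splitting fields force characteristic 2, and then
  \<open>p = t\<^sup>2 + l t + a\<close>, \<open>q = t\<^sup>2 + l t + b\<close> and \<open>r = t\<^sup>2 + l t + a + b\<close> with \<open>l \<noteq> 0\<close>;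
  moreover \<open>r\<close> is irreducible with root set \<open>Root p - Root q\<close>. Hence \<open>u\<close> is d-exceptional iff
  \<open>w = r(u)\<close> is nilpotent, and in that case the number of invariant factors \<open>r\<^sup>n\<close> with \<open>n > j\<close>
  is half the dimension of \<open>Ker w \<inter> Im w\<^sup>j\<close>. Conditions (ii) and (iii) both say that all these
  dimensions are multiples of 4.

  If \<open>u = A - B\<close> with \<open>p(A) = q(B) = 0\<close>, then \<open>A u + u A = w\<close> and \<open>A w = w (A + l)\<close>. So \<open>A\<close>
  acts on \<open>Ker w \<inter> Im w\<^sup>j\<close> and commutes there with \<open>u\<close>, which makes this space a vector space
  over \<open>F[t, x]/(r(t), p(x))\<close>, a field of degree 4. Conversely, on two copies of \<open>F[t]/(r\<^sup>n)\<close> a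
  suitable \<open>A\<close> is the derivation \<open>r d/dt\<close> plus the companion matrix of \<open>p\<close>.
\<close>

section \<open>Polynomials acting on a vector space\<close>

text \<open>The obstacle is that \<open>A\<close> and \<open>u\<close> commute only up to
  \<open>r(u)\<close>, so \<open>V\<close> itself is not a module over the quartic field. Only the
  socles, where \<open>r(u)\<close> vanishes, carry commuting actions of both. These are enough: up
  to the factor \<open>degree r\<close>, their dimensions form the partition conjugate to the
  exponents of the invariant factors and so determine them.

  For the converse, \<open>A u + u A = r(u)\<close> is the rule of a derivation sending
  \<open>t\<close> to \<open>r\<close>. Such a derivation alone satisfies
  \<open>x^2 + l x = 0\<close>, which is \<open>p\<close> without its constant term. A matrix with
  constant entries and characteristic polynomial \<open>p\<close> commutes with the derivation, and
  adding it restores the constant term, since the cross terms cancel in characteristic 2. The price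
  is a second copy of each block, and this is where the pairing of the invariant factors comes
  from.\<close>

locale endo_space = vector_space scale
  for scale :: "'a::field \<Rightarrow> 'b::ab_group_add \<Rightarrow> 'b" (infixr "*s" 75) +
  fixes u :: "'b \<Rightarrow> 'b"
  assumes endo_u: "endo scale u"
begin

sublocale u: Vector_Spaces.linear scale scale u
  using endo_u by (simp add: endo_def)

abbreviation act :: "'a poly \<Rightarrow> 'b \<Rightarrow> 'b" where
  "act f \<equiv> poly_endo scale f u"

lemma u_pow_add: "(u ^^ n) (x + y) = (u ^^ n) x + (u ^^ n) y"
  by (induction n) (auto simp: u.add)

lemma u_pow_scale: "(u ^^ n) (c *s x) = c *s (u ^^ n) x"
  by (induction n) (auto simp: u.scale)

lemma act_eq_sum:
  assumes "degree f \<le> n"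
  shows "act f v = (\<Sum>i\<le>n. coeff f i *s (u ^^ i) v)"
proof -
  have "(\<Sum>i\<le>n. coeff f i *s (u ^^ i) v) = (\<Sum>i\<le>degree f. coeff f i *s (u ^^ i) v)"
    by (rule sum.mono_neutral_right) (use assms in \<open>auto simp: coeff_eq_0\<close>)
  then show ?thesis by (simp add: poly_endo_def)
qed

lemma act_pCons [simp]: "act (pCons c f) v = c *s v + u (act f v)"
proof -
  have "act (pCons c f) v = (\<Sum>i\<le>Suc (degree f). coeff (pCons c f) i *s (u ^^ i) v)"
    by (rule act_eq_sum) (simp add: degree_pCons_le)
  also have "\<dots> = c *s v + (\<Sum>i\<le>degree f. coeff f i *s u ((u ^^ i) v))"
    by (subst sum.atMost_Suc_shift) simp
  also have "\<dots> = c *s v + u (act f v)"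
    by (simp add: poly_endo_def u.sum u.scale)
  finally show ?thesis .
qed

lemma act_0 [simp]: "act 0 v = 0"
  by (simp add: poly_endo_def)

lemma act_1 [simp]: "act 1 v = v"
  by (simp add: poly_endo_def)

lemma act_add: "act (f + g) v = act f v + act g v"
  using act_eq_sum[of "f + g" "max (degree f) (degree g)" v]
    act_eq_sum[of f "max (degree f) (degree g)" v] act_eq_sum[of g "max (degree f) (degree g)" v]
  by (simp add: degree_add_le_max scale_left_distrib sum.distrib)

lemma act_smult: "act (smult c f) v = c *s act f v"
  using act_eq_sum[of "smult c f" "degree f" v] act_eq_sum[of f "degree f" v]
  by (simp add: degree_smult_le scale_sum_right)

lemma act_uminus: "act (- f) v = - act f v"
  using act_smult[of "-1" f v] by simp

lemma act_diff: "act (f - g) v = act f v - act g v"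
  using act_add[of f "- g" v] by (simp add: act_uminus)

lemma act_sum: "act (\<Sum>i\<in>A. f i) v = (\<Sum>i\<in>A. act (f i) v)"
  by (induction A rule: infinite_finite_induct) (auto simp: act_add)

lemma act_vec_add: "act f (v + w) = act f v + act f w"
  by (simp add: poly_endo_def u_pow_add scale_right_distrib sum.distrib)

lemma act_vec_scale: "act f (c *s v) = c *s act f v"
  by (simp add: poly_endo_def u_pow_scale scale_sum_right mult.commute)

lemma act_vec_0 [simp]: "act f 0 = 0"
  using act_vec_scale[of f 0 0] by simp

lemma act_vec_uminus: "act f (- v) = - act f v"
  using act_vec_scale[of f "-1" v] by simp

lemma act_vec_diff: "act f (v - w) = act f v - act f w"
  using act_vec_add[of f v "- w"] by (simp add: act_vec_uminus)

lemma act_vec_sum: "act f (\<Sum>i\<in>A. v i) = (\<Sum>i\<in>A. act f (v i))"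
  by (induction A rule: infinite_finite_induct) (auto simp: act_vec_add)

lemma u_act: "u (act f v) = act f (u v)"
  by (simp add: poly_endo_def u.sum u.scale funpow_swap1)

lemma act_mult: "act (f * g) v = act f (act g v)"
  by (induction f) (auto simp: act_add act_smult)

lemma act_monom: "act (monom c n) v = c *s (u ^^ n) v"
  by (induction n) (auto simp: monom_0 monom_Suc u.scale)

lemma act_commute: "act f (act g v) = act g (act f v)"
  using act_mult[of f g v] act_mult[of g f v] by (simp add: mult.commute)

lemma act_dvd: "act f v = 0 \<Longrightarrow> f dvd g \<Longrightarrow> act g v = 0"
  by (metis act_mult act_vec_0 dvd_def mult.commute)

section \<open>Invariant subspaces and combinations with polynomial coefficients\<close>

definition invariant :: "'b set \<Rightarrow> bool" where
  "invariant S \<longleftrightarrow> subspace S \<and> (\<forall>v\<in>S. u v \<in> S)"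

lemma invariant_subspace: "invariant S \<Longrightarrow> subspace S"
  by (simp add: invariant_def)

lemma invariant_act: "invariant S \<Longrightarrow> v \<in> S \<Longrightarrow> act f v \<in> S"
  by (induction f) (auto simp: invariant_def subspace_0 subspace_add subspace_scale)

lemma linear_act: "Vector_Spaces.linear scale scale (act f)"
  by unfold_locales (auto simp: act_vec_add act_vec_scale)

lemma invariant_image:
  assumes "invariant S"
  shows "invariant (act f ` S)"
proof -
  interpret act: Vector_Spaces.linear scale scale "act f" by (rule linear_act)
  show ?thesis
    using assms by (auto simp: invariant_def u_act act.subspace_image)
qed

lemma invariant_UNIV: "invariant UNIV"
  by (simp add: invariant_def)

lemma invariant_kernel:
  assumes "invariant S"
  shows "invariant {v \<in> S. act f v = 0}"
  using assms unfolding invariant_def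
  by (auto intro!: subspaceI simp: subspace_0 subspace_add subspace_scale act_vec_add act_vec_scale
      simp flip: u_act)

text \<open>Coefficient families are functions on all of \<open>nat\<close> whose values from
  \<open>m\<close> on are ignored, so the submodule generated by the first \<open>m\<close> vectors
  is simply a range.\<close>

definition comb :: "nat \<Rightarrow> (nat \<Rightarrow> 'b) \<Rightarrow> (nat \<Rightarrow> 'a poly) \<Rightarrow> 'b" where
  "comb m vs f = (\<Sum>i<m. act (f i) (vs i))"

lemma comb_add: "comb m vs f + comb m vs g = comb m vs (\<lambda>i. f i + g i)"
  by (simp add: comb_def act_add sum.distrib)

lemma comb_diff: "comb m vs f - comb m vs g = comb m vs (\<lambda>i. f i - g i)"
  by (simp add: comb_def act_diff sum_subtractf)

lemma comb_scale: "c *s comb m vs f = comb m vs (\<lambda>i. smult c (f i))"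
  by (simp add: comb_def act_smult scale_sum_right)

lemma comb_u: "u (comb m vs f) = comb m vs (\<lambda>i. pCons 0 (f i))"
  by (simp add: comb_def u.sum)

lemma act_comb: "act g (comb m vs f) = comb m vs (\<lambda>i. g * f i)"
  by (simp add: comb_def act_mult act_vec_sum)

lemma comb_act: "comb m (\<lambda>i. act (g i) (vs i)) f = comb m vs (\<lambda>i. f i * g i)"
  by (simp add: comb_def act_mult)

lemma comb_0 [simp]: "comb m vs (\<lambda>i. 0) = 0"
  by (simp add: comb_def)

lemma comb_cong: "(\<And>i. i < m \<Longrightarrow> vs i = ws i) \<Longrightarrow> (\<And>i. i < m \<Longrightarrow> f i = g i) \<Longrightarrow>
    comb m vs f = comb m ws g"
  by (simp add: comb_def)

lemma comb_Suc: "comb (Suc m) vs f = comb m vs f + act (f m) (vs m)"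
  by (simp add: comb_def)

lemma comb_in: "invariant S \<Longrightarrow> (\<And>i. i < m \<Longrightarrow> vs i \<in> S) \<Longrightarrow> comb m vs f \<in> S"
  unfolding comb_def by (intro subspace_sum) (auto simp: invariant_subspace invariant_act)

lemma in_range_comb:
  assumes "i < m" shows "act g (vs i) \<in> range (comb m vs)"
proof -
  have "comb m vs (\<lambda>j. if j = i then g else 0) = act g (vs i)"
    using assms by (simp add: comb_def if_distrib[of "\<lambda>f. act f _"] cong: if_cong)
  then show ?thesis by (metis rangeI)
qed

text \<open>\<open>S\<close> is the internal direct sum of the cyclic modules generated by the \<open>vs i\<close>, which
  are isomorphic to \<open>F[t]/(ps i)\<close>.\<close>

definition cyclic_decomp :: "'b set \<Rightarrow> nat \<Rightarrow> (nat \<Rightarrow> 'a poly) \<Rightarrow> (nat \<Rightarrow> 'b) \<Rightarrow> bool" where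
  "cyclic_decomp S m ps vs \<longleftrightarrow> (\<forall>i<m. act (ps i) (vs i) = 0) \<and> range (comb m vs) = S \<and>
     (\<forall>f. comb m vs f = 0 \<longrightarrow> (\<forall>i<m. ps i dvd f i))"

lemma comb_eq_0:
  assumes "\<And>i. i < m \<Longrightarrow> act (ps i) (vs i) = 0" "\<And>i. i < m \<Longrightarrow> ps i dvd f i"
  shows "comb m vs f = 0"
  unfolding comb_def using assms by (intro sum.neutral) (auto intro: act_dvd)

lemma comb_eq_0_iff:
  assumes "cyclic_decomp S m ps vs"
  shows "comb m vs f = 0 \<longleftrightarrow> (\<forall>i<m. ps i dvd f i)"
  using assms comb_eq_0[of m ps vs f] by (auto simp: cyclic_decomp_def)

end

section \<open>Bases of cyclic decompositions\<close>

context vector_space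
begin

lemma sum_family_reindex:
  assumes "finite I" "inj_on b I"
  shows "(\<Sum>v\<in>b ` I. d v *s v) = (\<Sum>x\<in>I. d (b x) *s b x)"
  using assms by (simp add: sum.reindex)

text \<open>Independence of a set does not see repetitions, so for a family it has to be joined with
  injectivity. The right-hand side is the form in which relations between generators appear.\<close>

lemma inj_independent_family_iff:
  assumes "finite I"
  shows "inj_on b I \<and> independent (b ` I) \<longleftrightarrow>
    (\<forall>c. (\<Sum>x\<in>I. c x *s b x) = 0 \<longrightarrow> (\<forall>x\<in>I. c x = 0))" (is "?L \<longleftrightarrow> ?R")
proof
  assume L: ?L
  show ?R
  proof (intro allI impI ballI)
    fix c x assume c: "(\<Sum>x\<in>I. c x *s b x) = 0" and x: "x \<in> I"
    define d where "d v = c (inv_into I b v)" for v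
    have "(\<Sum>v\<in>b ` I. d v *s v) = (\<Sum>x\<in>I. c x *s b x)"
      using L assms by (subst sum_family_reindex) (auto simp: d_def intro!: sum.cong)
    then have "d (b x) = 0"
      using L c x assms by (metis (no_types, lifting) dependent_finite finite_imageI imageI)
    then show "c x = 0" using L x by (simp add: d_def)
  qed
next
  assume R: ?R
  have inj: "inj_on b I"
  proof (rule inj_onI, rule ccontr)
    fix x y assume xy: "x \<in> I" "y \<in> I" "b x = b y" "x \<noteq> y"
    define c where "c z = (if z = x then 1 else if z = y then -1 else (0::'a))" for z
    have "(\<Sum>z\<in>I. c z *s b z) = (\<Sum>z\<in>{x, y}. c z *s b z)"
      by (rule sum.mono_neutral_right) (use xy assms in \<open>auto simp: c_def\<close>)
    also have "\<dots> = 0" using xy by (simp add: c_def)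
    finally have "c x = 0" using R xy by blast
    then show False by (simp add: c_def)
  qed
  moreover have "independent (b ` I)"
  proof
    assume "dependent (b ` I)"
    then obtain d v where d: "v \<in> b ` I" "d v \<noteq> 0" "(\<Sum>v\<in>b ` I. d v *s v) = 0"
      using assms by (auto simp: dependent_finite)
    then have "(\<Sum>x\<in>I. d (b x) *s b x) = 0" using inj assms by (simp add: sum_family_reindex)
    then show False using R d by auto
  qed
  ultimately show ?L by blast
qed

lemma span_family:
  assumes "finite I"
  shows "span (b ` I) = range (\<lambda>c. \<Sum>x\<in>I. c x *s b x)" (is "_ = ?R")
proof
  have sub: "subspace ?R"
  proof (rule subspaceI)
    show "0 \<in> ?R" by (rule range_eqI[where x = "\<lambda>_. 0"]) simp
    show "x + y \<in> ?R" if xy: "x \<in> ?R" "y \<in> ?R" for x y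
    proof -
      from xy obtain c d where "x = (\<Sum>x\<in>I. c x *s b x)" "y = (\<Sum>x\<in>I. d x *s b x)" by auto
      then show ?thesis
        by (intro range_eqI[where x = "\<lambda>x. c x + d x"]) (simp add: scale_left_distrib sum.distrib)
    qed
    show "a *s x \<in> ?R" if "x \<in> ?R" for a x
    proof -
      from that obtain c where "x = (\<Sum>x\<in>I. c x *s b x)" by auto
      then show ?thesis
        by (intro range_eqI[where x = "\<lambda>x. a * c x"]) (simp add: scale_sum_right)
    qed
  qed
  have "b x \<in> ?R" if "x \<in> I" for x
  proof (rule range_eqI[where x = "\<lambda>y. if y = x then 1 else 0"])
    show "b x = (\<Sum>y\<in>I. (if y = x then 1 else 0) *s b y)"
      using that assms by (simp add: if_distrib[of "\<lambda>c. c *s _"] cong: if_cong)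
  qed
  then show "span (b ` I) \<subseteq> ?R"
    using sub by (intro span_minimal) auto
  show "?R \<subseteq> span (b ` I)"
    by (auto intro!: span_sum span_scale intro: span_base)
qed

end

context endo_space
begin

text \<open>The pair \<open>(i, j)\<close> stands for the class of \<open>t^j\<close> in
  \<open>F[t]/(ps i)\<close>; the powers below the degree form a basis of that quotient.\<close>

definition cyclic_index :: "nat \<Rightarrow> (nat \<Rightarrow> 'a poly) \<Rightarrow> (nat \<times> nat) set" where
  "cyclic_index m ps = (SIGMA i:{..<m}. {..<degree (ps i)})"

definition cyclic_vec :: "(nat \<Rightarrow> 'b) \<Rightarrow> nat \<times> nat \<Rightarrow> 'b" where
  "cyclic_vec vs = (\<lambda>(i, j). (u ^^ j) (vs i))"

lemma finite_cyclic_index [simp]: "finite (cyclic_index m ps)"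
  by (simp add: cyclic_index_def)

lemma card_cyclic_index: "card (cyclic_index m ps) = (\<Sum>i<m. degree (ps i))"
  by (simp add: cyclic_index_def)

definition coeff_poly :: "(nat \<Rightarrow> 'a poly) \<Rightarrow> (nat \<times> nat \<Rightarrow> 'a) \<Rightarrow> nat \<Rightarrow> 'a poly" where
  "coeff_poly ps c i = (\<Sum>j<degree (ps i). monom (c (i, j)) j)"

lemma coeff_coeff_poly: "coeff (coeff_poly ps c i) j = (if j < degree (ps i) then c (i, j) else 0)"
  by (simp add: coeff_poly_def coeff_sum)

lemma coeff_poly_eq_0:
  assumes "ps i dvd coeff_poly ps c i"
  shows "coeff_poly ps c i = 0"
proof (rule ccontr)
  assume nz: "coeff_poly ps c i \<noteq> 0"
  then have "degree (ps i) \<le> degree (coeff_poly ps c i)" using assms by (simp add: dvd_imp_degree_le)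
  then have "coeff (coeff_poly ps c i) (degree (coeff_poly ps c i)) = 0" by (simp add: coeff_coeff_poly)
  then show False using nz by simp
qed

lemma sum_cyclic_vec:
  "(\<Sum>x\<in>cyclic_index m ps. c x *s cyclic_vec vs x) = comb m vs (coeff_poly ps c)"
  by (simp add: cyclic_index_def cyclic_vec_def comb_def coeff_poly_def act_sum act_monom sum.Sigma
      split_beta)

lemma mod_eq_coeff_poly:
  assumes "\<And>i. i < m \<Longrightarrow> monic (ps i)" "i < m"
  shows "f i mod ps i = coeff_poly ps (\<lambda>(i, j). coeff (f i mod ps i) j) i"
proof (rule poly_eqI)
  fix j
  have "ps i \<noteq> 0" using assms by force
  then have "degree (f i mod ps i) < degree (ps i) \<or> f i mod ps i = 0"
    using degree_mod_less by blast
  then show "coeff (f i mod ps i) j =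
      coeff (coeff_poly ps (\<lambda>(i, j). coeff (f i mod ps i) j) i) j"
    by (auto simp: coeff_coeff_poly coeff_eq_0)
qed

lemma comb_mod:
  assumes "\<And>i. i < m \<Longrightarrow> act (ps i) (vs i) = 0"
  shows "comb m vs (\<lambda>i. f i mod ps i) = comb m vs f"
proof -
  have "comb m vs f - comb m vs (\<lambda>i. f i mod ps i) = 0"
    unfolding comb_diff by (rule comb_eq_0[OF assms]) (auto simp: minus_mod_eq_mult_div)
  then show ?thesis by simp
qed

text \<open>Reducing each coefficient modulo \<open>ps i\<close> does not change the combination, so
  only polynomials of degree below \<open>degree (ps i)\<close> matter, and these are the same as
  scalar families on \<open>cyclic_index\<close>.\<close>

lemma cyclic_decomp_iff_basis:
  assumes monic: "\<And>i. i < m \<Longrightarrow> monic (ps i)" and act: "\<And>i. i < m \<Longrightarrow> act (ps i) (vs i) = 0"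
  shows "cyclic_decomp S m ps vs \<longleftrightarrow>
    (inj_on (cyclic_vec vs) (cyclic_index m ps) \<and> independent (cyclic_vec vs ` cyclic_index m ps)) \<and>
    span (cyclic_vec vs ` cyclic_index m ps) = S"
proof -
  have red: "comb m vs f = comb m vs (coeff_poly ps (\<lambda>(i, j). coeff (f i mod ps i) j))" for f
  proof -
    have "comb m vs f = comb m vs (\<lambda>i. f i mod ps i)" using comb_mod[of m ps vs f] act by simp
    also have "\<dots> = comb m vs (coeff_poly ps (\<lambda>(i, j). coeff (f i mod ps i) j))"
    proof (rule comb_cong)
      fix i assume "i < m"
      then show "f i mod ps i = coeff_poly ps (\<lambda>(i, j). coeff (f i mod ps i) j) i"
        using mod_eq_coeff_poly[where m = m and ps = ps and i = i and f = f] monic by simp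
    qed simp
    finally show ?thesis .
  qed
  have range: "range (comb m vs) = range (\<lambda>c. comb m vs (coeff_poly ps c))"
    using red by (auto simp: image_iff)
  have "(\<forall>f. comb m vs f = 0 \<longrightarrow> (\<forall>i<m. ps i dvd f i)) \<longleftrightarrow>
    (\<forall>c. comb m vs (coeff_poly ps c) = 0 \<longrightarrow> (\<forall>x\<in>cyclic_index m ps. c x = 0))" (is "?L \<longleftrightarrow> ?R")
  proof
    assume L: ?L
    show ?R
    proof (intro allI impI ballI)
      fix c x assume "comb m vs (coeff_poly ps c) = 0" and x: "x \<in> cyclic_index m ps"
      then have "\<forall>i<m. coeff_poly ps c i = 0" using L coeff_poly_eq_0 by blast
      moreover obtain i j where ij: "x = (i, j)" "i < m" "j < degree (ps i)"
        using x by (auto simp: cyclic_index_def)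
      ultimately show "c x = 0" using coeff_coeff_poly[of ps c i j] by simp
    qed
  next
    assume R: ?R
    show ?L
    proof (intro allI impI)
      fix f i assume f: "comb m vs f = 0" and i: "i < m"
      have "\<forall>x\<in>cyclic_index m ps. (case x of (i, j) \<Rightarrow> coeff (f i mod ps i) j) = 0"
        using R f red[of f] by (auto simp: case_prod_unfold)
      then have "\<And>j. j < degree (ps i) \<Longrightarrow> coeff (f i mod ps i) j = 0"
        using i by (auto simp: cyclic_index_def)
      then have "coeff_poly ps (\<lambda>(i, j). coeff (f i mod ps i) j) i = 0"
        by (intro poly_eqI) (simp add: coeff_coeff_poly)
      then have "f i mod ps i = 0" using mod_eq_coeff_poly[where m = m and ps = ps and i = i and f = f] monic i by simp
      then show "ps i dvd f i" by (simp add: mod_eq_0_iff_dvd)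
    qed
  qed
  then show ?thesis
    using act unfolding cyclic_decomp_def
    by (simp add: inj_independent_family_iff span_family sum_cyclic_vec range)
      blast
qed

lemma cyclic_decomp_dim:
  assumes monic: "\<And>i. i < m \<Longrightarrow> monic (ps i)" and dec: "cyclic_decomp S m ps vs"
  shows "dim S = (\<Sum>i<m. degree (ps i))"
proof -
  have "\<And>i. i < m \<Longrightarrow> act (ps i) (vs i) = 0" using dec by (simp add: cyclic_decomp_def)
  then have *: "inj_on (cyclic_vec vs) (cyclic_index m ps)"
      "independent (cyclic_vec vs ` cyclic_index m ps)"
      "span (cyclic_vec vs ` cyclic_index m ps) = S"
    using cyclic_decomp_iff_basis[OF monic] dec by auto
  then have "dim S = card (cyclic_vec vs ` cyclic_index m ps)"
    using dim_eq_card_independent[OF *(2)] dim_span[of "cyclic_vec vs ` cyclic_index m ps"] by simp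
  then show ?thesis using * by (simp add: card_image card_cyclic_index)
qed

end

section \<open>Annihilating polynomials and the minimal polynomial\<close>

locale fin_dim_endo = endo_space scale u + finite_dimensional_vector_space scale Basis
  for scale :: "'a::field \<Rightarrow> 'b::ab_group_add \<Rightarrow> 'b" (infixr "*s" 75)
    and u :: "'b \<Rightarrow> 'b" and Basis :: "'b set"
begin

lemma exists_annihilating_poly_vec: "\<exists>f. f \<noteq> 0 \<and> act f v = 0"
proof -
  define n where "n = Suc (dimension)"
  have "\<not> (inj_on (\<lambda>i. (u ^^ i) v) {..<n} \<and> independent ((\<lambda>i. (u ^^ i) v) ` {..<n}))"
  proof
    assume *: "inj_on (\<lambda>i. (u ^^ i) v) {..<n} \<and> independent ((\<lambda>i. (u ^^ i) v) ` {..<n})"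
    then have "card ((\<lambda>i. (u ^^ i) v) ` {..<n}) = n" by (simp add: card_image)
    then show False
      using * independent_card_le_dim[of "(\<lambda>i. (u ^^ i) v) ` {..<n}" UNIV]
      by (simp add: n_def dim_UNIV dimension_def)
  qed
  then obtain c k where c: "(\<Sum>i<n. c i *s (u ^^ i) v) = 0" and k: "k < n" "c k \<noteq> 0"
    by (subst (asm) inj_independent_family_iff) auto
  define f where "f = (\<Sum>i<n. monom (c i) i)"
  have "coeff f k = c k" using k by (simp add: f_def coeff_sum)
  then have "f \<noteq> 0" using k by auto
  moreover have "act f v = 0" using c by (simp add: f_def act_sum act_monom)
  ultimately show ?thesis by blast
qed

lemma exists_annihilating_poly: "\<exists>f. f \<noteq> 0 \<and> annihilates scale f u"
proof -
  obtain g where g: "\<And>v. g v \<noteq> 0" "\<And>v. act (g v) v = 0"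
    using exists_annihilating_poly_vec by metis
  define f where "f = (\<Prod>v\<in>Basis. g v)"
  interpret act: Vector_Spaces.linear scale scale "act f" by (rule linear_act)
  have "act f v = 0" if "v \<in> Basis" for v
    using act_dvd[OF g(2)] that by (simp add: f_def finite_Basis dvd_prod_eqI)
  then have "act f v = 0" for v
    using act.eq_0_on_span[of Basis v] span_Basis by simp
  moreover have "f \<noteq> 0" using g by (simp add: f_def finite_Basis)
  ultimately show ?thesis by (auto simp: annihilates_def)
qed

lemma annihilates_dvd: "annihilates scale f u \<Longrightarrow> f dvd g \<Longrightarrow> annihilates scale g u"
  unfolding annihilates_def using act_dvd by blast

text \<open>A nonzero annihilator of least degree, made monic, divides all others by division with
  remainder, and monic polynomials dividing each other are equal. So the definite description in
  \<open>minimal_poly\<close> has exactly one solution.\<close>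

lemma minimal_poly_props:
  shows "monic (minimal_poly scale u)" "annihilates scale (minimal_poly scale u) u"
    "annihilates scale f u \<longleftrightarrow> minimal_poly scale u dvd f"
proof -
  let ?P = "\<lambda>m. monic m \<and> annihilates scale m u \<and> (\<forall>f. annihilates scale f u \<longrightarrow> m dvd f)"
  obtain m0 where m0: "m0 \<noteq> 0 \<and> annihilates scale m0 u"
    and min: "\<And>f. f \<noteq> 0 \<and> annihilates scale f u \<Longrightarrow> degree m0 \<le> degree f"
    using exists_annihilating_poly ex_has_least_nat[of "\<lambda>f. f \<noteq> 0 \<and> annihilates scale f u" _ degree]
    by metis
  define m where "m = smult (inverse (lead_coeff m0)) m0"
  have m: "monic m" "annihilates scale m u" "degree m = degree m0"
    using m0 by (auto simp: m_def annihilates_def act_smult)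
  have "m dvd f" if f: "annihilates scale f u" for f
  proof (rule ccontr)
    assume "\<not> m dvd f"
    then have nz: "f mod m \<noteq> 0" by (simp add: mod_eq_0_iff_dvd)
    have "act (f mod m) v = 0" for v
      using f m(2) by (simp add: annihilates_def act_diff act_mult flip: minus_div_mult_eq_mod)
    then have "degree m0 \<le> degree (f mod m)" using min nz by (simp add: annihilates_def)
    moreover have "degree (f mod m) < degree m"
      using degree_mod_less[of m f] nz m(1) by fastforce
    ultimately show False using m(3) by simp
  qed
  then have P: "?P m" using m by blast
  have uniq: "m' = m" if "?P m'" for m'
    using that P by (intro poly_dvd_antisym) auto
  have "minimal_poly scale u = m"
    unfolding minimal_poly_def using P uniq by (rule the_equality)
  then have *: "monic (minimal_poly scale u)" "annihilates scale (minimal_poly scale u) u"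
    "annihilates scale f u \<Longrightarrow> minimal_poly scale u dvd f"
    using P by simp_all
  then show "monic (minimal_poly scale u)" "annihilates scale (minimal_poly scale u) u"
    by blast+
  show "annihilates scale f u \<longleftrightarrow> minimal_poly scale u dvd f"
    using * annihilates_dvd by blast
qed

end

section \<open>Primary endomorphisms\<close>

lemma irreducible_poly_degree_pos: "irreducible r \<Longrightarrow> degree (r :: 'a::field poly) > 0"
  by (metis irreducible_def is_unit_iff_degree neq0_conv not_irreducible_zero)

text \<open>A variant of Euclid's algorithm in which \<open>r\<close> stays fixed: \<open>g\<close>
  is replaced by \<open>g mod r\<close> if its degree is at least that of \<open>r\<close>, and by
  \<open>r mod g\<close> otherwise. Irreducibility of \<open>r\<close> keeps the remainder nonzero
  until \<open>g\<close> is constant.\<close>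

lemma irreducible_poly_bezout:
  fixes r g :: "'a::field poly"
  assumes "irreducible r" "\<not> r dvd g"
  shows "\<exists>a b. a * g + b * r = 1"
  using assms(2)
proof (induction "if degree g < degree r then degree g else degree g + degree r + 1"
    arbitrary: g rule: less_induct)
  case less
  have r: "r \<noteq> 0" using assms(1) by auto
  have g: "g \<noteq> 0" using less.prems by auto
  have dr: "degree r > 0" using assms(1) by (rule irreducible_poly_degree_pos)
  show ?case
  proof (cases "degree g < degree r")
    case False
    have nd: "\<not> r dvd g mod r" using less.prems by (simp add: dvd_mod_iff)
    have "degree (g mod r) < degree r" using degree_mod_less[OF r, of g] dr by auto
    then obtain a b where "a * (g mod r) + b * r = 1" using less.hyps[OF _ nd] False by auto
    then have "a * (g - g div r * r) + b * r = 1" by (simp add: minus_div_mult_eq_mod)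
    then have "a * g + (b - a * (g div r)) * r = 1" by (simp add: algebra_simps)
    then show ?thesis by blast
  next
    case True
    show ?thesis
    proof (cases "degree g = 0")
      case True
      then obtain c where "g = [:c:]" "c \<noteq> 0" using g True by (metis degree_eq_zeroE pCons_0_0)
      then have "[:inverse c:] * g + 0 * r = 1" by (simp add: one_pCons)
      then show ?thesis by blast
    next
      case False
      have "\<not> g dvd r"
      proof
        assume "g dvd r"
        then obtain h where h: "r = g * h" by (elim dvdE)
        then have "is_unit h" using assms(1) False irreducibleD[of r g h] is_unit_iff_degree[OF g] by auto
        then show False using h less.prems by (simp add: mult_unit_dvd_iff)
      qed
      then have nz: "r mod g \<noteq> 0" by (simp add: mod_eq_0_iff_dvd)
      have deg: "degree (r mod g) < degree g" using degree_mod_less[OF g, of r] nz by auto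
      have "\<not> r dvd r mod g" using deg True nz by (metis dvd_imp_degree_le leD less_trans)
      then obtain a b where "a * (r mod g) + b * r = 1"
        using less.hyps[of "r mod g"] deg True by auto
      then have "a * (r - r div g * g) + b * r = 1" by (simp add: minus_div_mult_eq_mod)
      then have "(- a * (r div g)) * g + (a + b) * r = 1" by (simp add: algebra_simps)
      then show ?thesis by blast
    qed
  qed
qed

text \<open>Since \<open>r\<close> is prime, one factor \<open>r\<close> can be cancelled at each
  step, either from \<open>d\<close> or from its cofactor in \<open>r ^ n\<close>.\<close>

lemma monic_dvd_irreducible_power:
  fixes r d :: "'a::field poly"
  assumes "irreducible r" "monic r" "monic d" "d dvd r ^ n"
  shows "\<exists>k\<le>n. d = r ^ k"
  using assms(3,4)
proof (induction n arbitrary: d)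
  case 0
  then show ?case by (intro exI[of _ 0]) (simp add: poly_dvd_1 monic_degree_0)
next
  case (Suc n)
  have prime: "prime_elem r" using assms(1) by (rule field_poly_irreducible_imp_prime)
  obtain e where e: "r ^ Suc n = d * e" using Suc.prems by (elim dvdE)
  show ?case
  proof (cases "r dvd d")
    case True
    then obtain d' where d': "d = r * d'" by (elim dvdE)
    have "r \<noteq> 0" using assms(1) by auto
    then have "d' dvd r ^ n" using Suc.prems d' by simp
    moreover have "monic d'" using d' Suc.prems assms(2) by (simp add: lead_coeff_mult)
    ultimately obtain k where "k \<le> n" "d' = r ^ k" using Suc.IH by blast
    then show ?thesis using d' by (intro exI[of _ "Suc k"]) simp
  next
    case False
    then have "r dvd e" using e prime by (metis dvd_triv_left power_Suc prime_elem_dvd_mult_iff)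
    then obtain e' where "e = r * e'" by (elim dvdE)
    moreover have "r \<noteq> 0" using assms(1) by auto
    ultimately have "d dvd r ^ n" using e by (auto simp: mult.left_commute)
    then obtain k where "k \<le> n" "d = r ^ k" using Suc.IH Suc.prems by blast
    then show ?thesis by (intro exI[of _ k]) auto
  qed
qed

section \<open>Primary decompositions and their socles\<close>

context fin_dim_endo
begin

lemma cyclic_decomp_length_le:
  assumes "\<And>i. i < m \<Longrightarrow> monic (ps i)" "\<And>i. i < m \<Longrightarrow> degree (ps i) > 0" "cyclic_decomp S m ps vs"
  shows "m \<le> dim S"
proof -
  have "m = (\<Sum>i<m. 1)" by simp
  also have "\<dots> \<le> (\<Sum>i<m. degree (ps i))" using assms(2) by (intro sum_mono) (auto simp: Suc_leI)
  also have "\<dots> = dim S" using cyclic_decomp_dim[OF assms(1,3)] by simp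
  finally show ?thesis .
qed

text \<open>A decomposition of \<open>r(u) S\<close> lifts to \<open>S\<close>: choose preimages of its generators under
  \<open>r(u)\<close>, which raises every exponent by one, and add vectors of the kernel of \<open>r(u)\<close> as long as
  they are not in the submodule generated so far.\<close>

lemma primary_cyclic_decomp:
  assumes r: "irreducible r" "monic r"
  assumes "invariant S" "\<And>v. v \<in> S \<Longrightarrow> act (r ^ N) v = 0"
  shows "\<exists>m n vs. (\<forall>i<m. 1 \<le> n i) \<and> (\<forall>i j. i \<le> j \<longrightarrow> j < m \<longrightarrow> n j \<le> n i) \<and>
    cyclic_decomp S m (\<lambda>i. r ^ n i) vs"
  using assms(3,4)
proof (induction N arbitrary: S)
  case 0
  then have "S = {0}" using invariant_subspace[OF 0(1)] subspace_0[of S] by auto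
  then have "cyclic_decomp S 0 (\<lambda>i. r ^ undefined i) undefined"
    by (simp add: cyclic_decomp_def comb_def)
  then show ?case by (intro exI[of _ 0] exI[of _ undefined]) simp
next
  case (Suc N)
  have dr: "degree r > 0" using r(1) by (rule irreducible_poly_degree_pos)
  have r0: "r \<noteq> 0" using r by auto
  have monic: "monic (r ^ k)" for k using r(2) by (rule monic_power)
  have deg: "degree (r ^ k) > 0" if "1 \<le> k" for k using that dr r0 by (simp add: degree_power_eq)
  have "\<exists>m n vs. (\<forall>i<m. 1 \<le> n i) \<and> (\<forall>i j. i \<le> j \<longrightarrow> j < m \<longrightarrow> n j \<le> n i) \<and>
    cyclic_decomp (act r ` S) m (\<lambda>i. r ^ n i) vs"
    using Suc.prems invariant_image[of S r]
    by (intro Suc.IH) (auto simp: simp flip: act_mult power_Suc2 simp del: power_Suc)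
  then obtain m0 n0 ws where n0: "\<And>i. i < m0 \<Longrightarrow> 1 \<le> n0 i"
    "\<And>i j. i \<le> j \<Longrightarrow> j < m0 \<Longrightarrow> n0 j \<le> n0 i"
    and ws: "cyclic_decomp (act r ` S) m0 (\<lambda>i. r ^ n0 i) ws" by blast
  have "ws i \<in> act r ` S" if "i < m0" for i
    using in_range_comb[OF that, of 1 ws] ws by (simp add: cyclic_decomp_def)
  then have "\<forall>i. \<exists>v. i < m0 \<longrightarrow> v \<in> S \<and> ws i = act r v" by blast
  then obtain vs0 where "\<forall>i. i < m0 \<longrightarrow> vs0 i \<in> S \<and> ws i = act r (vs0 i)" by metis
  then have vs0: "\<And>i. i < m0 \<Longrightarrow> vs0 i \<in> S" "\<And>i. i < m0 \<Longrightarrow> ws i = act r (vs0 i)"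
    by simp_all
  have comb0: "comb m0 ws f = act r (comb m0 vs0 f)" for f
    using comb_cong[of m0 ws "\<lambda>i. act r (vs0 i)" f f] vs0(2)
    by (simp add: comb_act act_comb mult.commute)
  \<comment> \<open>A partial decomposition: a submodule \<open>G\<close> of \<open>S\<close> that
    is already a direct sum of cyclic ones. The last clause says that \<open>S\<close> is
    \<open>G\<close> plus the kernel of \<open>r(u)\<close> in \<open>S\<close>, so only kernel
    vectors can be missing.\<close>
  define P where "P m n vs \<longleftrightarrow> (\<forall>i<m. 1 \<le> n i) \<and> (\<forall>i j. i \<le> j \<longrightarrow> j < m \<longrightarrow> n j \<le> n i) \<and>
     range (comb m vs) \<subseteq> S \<and> cyclic_decomp (range (comb m vs)) m (\<lambda>i. r ^ n i) vs \<and>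
     (\<forall>v\<in>S. \<exists>f. act r (v - comb m vs f) = 0)" for m n vs
  have "P m0 (\<lambda>i. Suc (n0 i)) vs0"
    unfolding P_def cyclic_decomp_def
  proof (intro conjI allI impI ballI)
    fix i assume i: "i < m0"
    have "act (r ^ n0 i) (ws i) = 0" using ws i by (simp add: cyclic_decomp_def)
    then show "act (r ^ Suc (n0 i)) (vs0 i) = 0"
      using vs0(2)[OF i] by (simp add: mult.commute[of r] act_mult)
  next
    fix f i assume f: "comb m0 vs0 f = 0" and i: "i < m0"
    then have "\<forall>i<m0. r ^ n0 i dvd f i" using comb0[of f] comb_eq_0_iff[OF ws] by simp
    \<comment> \<open>One factor \<open>r\<close> is split off so that the relation between the
      \<open>vs0\<close> becomes a relation between the \<open>ws\<close>, the images under
      \<open>r(u)\<close>. Using their independence a second time gains the missing power of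
      \<open>r\<close>.\<close>
    then obtain h where h: "\<And>i. i < m0 \<Longrightarrow> f i = h i * r ^ (n0 i - 1) * r"
    proof -
      assume that: "\<And>h. (\<And>i. i < m0 \<Longrightarrow> f i = h i * r ^ (n0 i - 1) * r) \<Longrightarrow> thesis"
      have "f i = (f i div r ^ n0 i) * r ^ (n0 i - 1) * r" if "i < m0" for i
        using \<open>\<forall>i<m0. r ^ n0 i dvd f i\<close> n0(1)[OF that] that
        by (simp add: mult.assoc flip: power_Suc2)
      then show thesis by (rule that)
    qed
    have "comb m0 ws (\<lambda>i. h i * r ^ (n0 i - 1)) = comb m0 vs0 (\<lambda>i. h i * r ^ (n0 i - 1) * r)"
      by (simp add: comb0 act_comb mult.commute)
    also have "\<dots> = 0" using comb_cong[of m0 vs0 vs0 f] h f by simp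
    finally have "\<forall>i<m0. r ^ n0 i dvd h i * r ^ (n0 i - 1)" unfolding comb_eq_0_iff[OF ws] .
    then have "r ^ n0 i dvd h i * r ^ (n0 i - 1)" using i by simp
    then have "r ^ n0 i * r dvd f i" using h[OF i] by (simp add: mult_dvd_mono)
    then show "r ^ Suc (n0 i) dvd f i" by (simp add: mult.commute)
  next
    fix v assume "v \<in> S"
    then have "act r v \<in> range (comb m0 ws)" using ws by (auto simp: cyclic_decomp_def)
    then obtain f where "act r v = comb m0 ws f" by auto
    then have "act r (v - comb m0 vs0 f) = 0" by (simp add: comb0 act_vec_diff)
    then show "\<exists>f. act r (v - comb m0 vs0 f) = 0" by (rule exI[of _ f])
  next
    show "range (comb m0 vs0) \<subseteq> S" using comb_in[OF Suc.prems(1)] vs0(1) by auto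
  qed (use n0 in auto)
  then have ex: "\<exists>m n vs. P m n vs" by blast
  \<comment> \<open>Every generator contributes at least one dimension, so a partial decomposition
    with the largest number of summands exists.\<close>
  have bound: "m \<le> dim (UNIV :: 'b set)" if P: "P m n vs" for m n vs
  proof -
    have "m \<le> dim (range (comb m vs))"
      by (rule cyclic_decomp_length_le[where ps = "\<lambda>i. r ^ n i"]) (use P monic deg in \<open>auto simp: P_def\<close>)
    also have "\<dots> \<le> dim (UNIV :: 'b set)" by (rule dim_subset) simp
    finally show ?thesis .
  qed
  let ?Q = "\<lambda>m. \<exists>n vs. P m n vs"
  define m where "m = (GREATEST m. ?Q m)"
  have bound': "\<And>y. ?Q y \<Longrightarrow> y \<le> dim (UNIV :: 'b set)" using bound by blast
  have "?Q m" unfolding m_def by (rule GreatestI_ex_nat[of ?Q, OF ex bound'])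
  have max: "m' \<le> m" if "?Q m'" for m' unfolding m_def using that bound' by (rule Greatest_le_nat[of ?Q])
  from \<open>?Q m\<close> obtain n vs where P: "P m n vs" by blast
  let ?G = "range (comb m vs)"
  have dec: "cyclic_decomp ?G m (\<lambda>i. r ^ n i) vs" using P by (simp add: P_def)
  \<comment> \<open>A kernel vector outside \<open>G\<close> would generate one more direct summand,
    isomorphic to \<open>F[t]/(r)\<close>. Its exponent 1 is the smallest allowed, so appending it
    keeps the exponents decreasing.\<close>
  have ker: "e \<in> ?G" if e: "e \<in> S" "act r e = 0" for e
  proof (rule ccontr)
    assume notin: "e \<notin> ?G"
    define n' where "n' = n(m := 1)"
    define vs' where "vs' = vs(m := e)"
    have comb': "comb (Suc m) vs' f = comb m vs f + act (f m) e" for f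
      using comb_cong[of m vs' vs f f] by (simp add: comb_Suc vs'_def)
    have "P (Suc m) n' vs'"
      unfolding P_def cyclic_decomp_def
    proof (intro conjI allI impI ballI)
      fix i assume "i < Suc m"
      then show "act (r ^ n' i) (vs' i) = 0"
        using e dec by (auto simp: n'_def vs'_def cyclic_decomp_def less_Suc_eq)
    next
      fix f i assume f: "comb (Suc m) vs' f = 0" and i: "i < Suc m"
      have "r dvd f m"
      proof (rule ccontr)
        assume "\<not> r dvd f m"
        \<comment> \<open>If \<open>f m\<close> is invertible modulo \<open>r\<close>, then
          \<open>e\<close> is recovered from \<open>act (f m) e\<close>, which the relation places
          in \<open>G\<close>.\<close>
        then obtain a b where ab: "a * f m + b * r = 1" using irreducible_poly_bezout[OF r(1)] by blast
        have "e = act (a * f m + b * r) e" by (simp add: ab)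
        also have "\<dots> = act a (act (f m) e)" using e by (simp add: act_add act_mult)
        also have "act (f m) e = comb m vs (\<lambda>i. - f i)"
          using f comb_diff[of m vs "\<lambda>_. 0" f] by (simp add: comb' add_eq_0_iff)
        finally have "e \<in> ?G" by (simp add: act_comb)
        then show False using notin by simp
      qed
      moreover from this have "act (f m) e = 0" using e by (auto intro: act_dvd)
      then have "comb m vs f = 0" using f by (simp add: comb')
      then have "\<forall>i<m. r ^ n i dvd f i" unfolding comb_eq_0_iff[OF dec] .
      ultimately show "r ^ n' i dvd f i" using i by (auto simp: n'_def less_Suc_eq)
    next
      fix v assume "v \<in> S"
      then obtain f where f: "act r (v - comb m vs f) = 0" using P by (auto simp: P_def)
      have "comb (Suc m) vs' (f(m := 0)) = comb m vs f"
        unfolding comb' by (simp add: comb_def)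
      then show "\<exists>f. act r (v - comb (Suc m) vs' f) = 0" using f by metis
    next
      fix i assume "i < Suc m" then show "1 \<le> n' i"
        using P by (auto simp: n'_def P_def less_Suc_eq)
    next
      fix i j :: nat assume "i \<le> j" "j < Suc m"
      then show "n' j \<le> n' i"
        using P by (auto simp: n'_def P_def less_Suc_eq)
    next
      have "act f e \<in> S" for f using invariant_act Suc.prems(1) e by blast
      then show "range (comb (Suc m) vs') \<subseteq> S"
        using P invariant_subspace[OF Suc.prems(1)]
        by (auto simp: comb' P_def intro!: subspace_add)
    qed simp
    then show False using max[of "Suc m"] by auto
  qed
  have "?G = S"
  proof
    show "?G \<subseteq> S" using P by (simp add: P_def)
    show "S \<subseteq> ?G"
    proof
      fix v assume v: "v \<in> S"
      then obtain f where f: "act r (v - comb m vs f) = 0" using P by (auto simp: P_def)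
      have "v - comb m vs f \<in> S"
        using v P invariant_subspace[OF Suc.prems(1)] by (auto simp: P_def intro!: subspace_diff)
      then obtain g where "v - comb m vs f = comb m vs g" using ker f by auto
      then have "v = comb m vs (\<lambda>i. g i + f i)" by (simp add: algebra_simps flip: comb_add)
      then show "v \<in> ?G" by simp
    qed
  qed
  then show ?case using P by (auto simp: P_def)
qed

text \<open>In \<open>F[t]/(r^n)\<close> the elements killed by \<open>r\<close> are the multiples
  of \<open>r^(n-1)\<close>, and they lie in the image of \<open>r^j\<close> when
  \<open>j < n\<close>; for \<open>j >= n\<close> that image is zero. A summand that contributes
  nothing is kept with modulus 1 and generator 0, so that the indices do not change.\<close>

lemma cyclic_decomp_socle:
  assumes r: "irreducible r" "monic r" and dec: "cyclic_decomp S m (\<lambda>i. r ^ n i) vs"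
  shows "cyclic_decomp {v \<in> act (r ^ j) ` S. act r v = 0} m
    (\<lambda>i. if j < n i then r else 1) (\<lambda>i. if j < n i then act (r ^ (n i - 1)) (vs i) else 0)"
  (is "cyclic_decomp ?T m ?ps ?vs")
proof -
  have r0: "r \<noteq> 0" using r by auto
  have S: "S = range (comb m vs)" and ann: "\<And>i. i < m \<Longrightarrow> act (r ^ n i) (vs i) = 0"
    using dec by (auto simp: cyclic_decomp_def)
  have comb': "comb m ?vs f = comb m vs (\<lambda>i. if j < n i then f i * r ^ (n i - 1) else 0)" for f
    unfolding comb_def by (rule sum.cong) (auto simp: act_mult)
  show ?thesis
    unfolding cyclic_decomp_def
  proof (intro conjI allI impI)
    fix i assume i: "i < m"
    have "act r (act (r ^ (n i - 1)) (vs i)) = act (r ^ n i) (vs i)" if "j < n i"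
      using that by (cases "n i") (auto simp flip: act_mult)
    then show "act (?ps i) (?vs i) = 0" using ann i by auto
  next
    fix f i assume f: "comb m ?vs f = 0" and i: "i < m"
    then have "r ^ n i dvd (if j < n i then f i * r ^ (n i - 1) else 0)"
      unfolding comb' comb_eq_0_iff[OF dec] by simp
    then have "j < n i \<Longrightarrow> r * r ^ (n i - 1) dvd f i * r ^ (n i - 1)"
      by (cases "n i") auto
    then show "?ps i dvd f i" using r0 by auto
  next
    show "range (comb m ?vs) = ?T"
    proof
      show "range (comb m ?vs) \<subseteq> ?T"
      proof clarsimp
        fix f
        have "comb m ?vs f = act (r ^ j) (comb m vs (\<lambda>i. if j < n i then f i * r ^ (n i - 1 - j) else 0))"
          unfolding comb' act_comb
          by (rule comb_cong) (auto simp: algebra_simps simp flip: power_add)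
        then have "comb m ?vs f \<in> act (r ^ j) ` S" unfolding S by blast
        moreover have "act r (comb m ?vs f) = 0"
          unfolding act_comb comb'
        proof (rule comb_eq_0[OF ann])
          fix i
          show "r ^ n i dvd (r * (if j < n i then f i * r ^ (n i - 1) else 0))" by (cases "n i") auto
        qed
        ultimately show "comb m ?vs f \<in> act (r ^ j) ` S \<and> act r (comb m ?vs f) = 0" by blast
      qed
      show "?T \<subseteq> range (comb m ?vs)"
      proof clarsimp
        fix v assume v: "v \<in> S" "act r (act (r ^ j) v) = 0"
        then obtain f where f: "v = comb m vs f" using S by auto
        have "comb m vs (\<lambda>i. r ^ Suc j * f i) = 0"
          using v by (simp add: f act_comb mult.assoc)
        then have dvd: "\<And>i. i < m \<Longrightarrow> r ^ n i dvd r ^ Suc j * f i" unfolding comb_eq_0_iff[OF dec] by simp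
        have "\<exists>h. act (r ^ j * f i) (vs i) = act h (?vs i)" if i: "i < m" for i
        proof (cases "j < n i")
          case False
          then have "r ^ n i dvd r ^ j * f i" by (simp add: le_imp_power_dvd)
          then have "act (r ^ j * f i) (vs i) = 0" using ann[OF i] by (auto intro: act_dvd)
          then show ?thesis using False by simp
        next
          case True
          then have "r ^ n i = r ^ Suc j * r ^ (n i - Suc j)" by (simp flip: power_add power_Suc)
          then have "r ^ (n i - Suc j) dvd f i" using dvd[OF i] r0 by simp
          then obtain h where h: "f i = r ^ (n i - Suc j) * h" by (elim dvdE)
          have "r ^ j * f i = h * r ^ (n i - 1)"
            using True by (simp add: h mult.commute mult.left_commute flip: power_add)
          then have "act (r ^ j * f i) (vs i) = act h (?vs i)" using True by (simp add: act_mult)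
          then show ?thesis by (rule exI[of _ h])
        qed
        then obtain h where h: "\<And>i. i < m \<Longrightarrow> act (r ^ j * f i) (vs i) = act (h i) (?vs i)"
          by metis
        have "act (r ^ j) v = comb m ?vs h"
          unfolding f act_comb unfolding comb_def by (rule sum.cong) (use h in auto)
        then show "act (r ^ j) v \<in> range (comb m ?vs)" by simp
      qed
    qed
  qed
qed

lemma dim_socle:
  assumes r: "irreducible r" "monic r" and dec: "cyclic_decomp S m (\<lambda>i. r ^ n i) vs"
  shows "dim {v \<in> act (r ^ j) ` S. act r v = 0} = degree r * card {i. i < m \<and> j < n i}"
proof -
  have "dim {v \<in> act (r ^ j) ` S. act r v = 0} = (\<Sum>i<m. degree (if j < n i then r else 1))"
    by (rule cyclic_decomp_dim[OF _ cyclic_decomp_socle[OF assms]]) (use r in auto)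
  also have "\<dots> = (\<Sum>i<m. if j < n i then degree r else 0)" by (rule sum.cong) auto
  also have "\<dots> = (\<Sum>i\<in>{i. i < m \<and> j < n i}. degree r)"
    by (rule sum.mono_neutral_cong_right) auto
  finally show ?thesis by simp
qed

end

section \<open>Invariant factors\<close>

lemma sum_lessThan_add:
  fixes f :: "nat \<Rightarrow> 'c::comm_monoid_add"
  shows "(\<Sum>i<n + k. f i) = (\<Sum>i<n. f i) + (\<Sum>i<k. f (n + i))"
  by (induction k) (auto simp: algebra_simps)

lemma all_less_add: "(\<forall>j<n + k. P j) \<longleftrightarrow> (\<forall>j<n. P j) \<and> (\<forall>j<k. P (n + j))" for n k :: nat
proof
  assume *: "(\<forall>j<n. P j) \<and> (\<forall>j<k. P (n + j))"
  show "\<forall>j<n + k. P j"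
  proof (intro allI impI)
    fix j assume "j < n + k"
    then show "P j" using * by (cases "j < n") (auto dest: spec[of _ "j - n"])
  qed
qed auto

lemma companion_mat_carrier [simp]: "companion_mat p \<in> carrier_mat (degree p) (degree p)"
  by (simp add: companion_mat_def)

section \<open>Block-diagonal and companion matrices as cyclic decompositions\<close>

context endo_space
begin

text \<open>The basis condition is separated from \<open>represented_in\<close> because it does not
  split along blocks: the sublist that belongs to one block need not be a basis of the
  space.\<close>

definition acts_by_mat :: "'b list \<Rightarrow> 'a mat \<Rightarrow> bool" where
  "acts_by_mat bs M \<longleftrightarrow> M \<in> carrier_mat (length bs) (length bs) \<and>
     (\<forall>j<length bs. u (bs ! j) = (\<Sum>i<length bs. M $$ (i, j) *s bs ! i))"

lemma represented_in_iff: "represented_in scale bs u M \<longleftrightarrow> ordered_basis scale bs \<and> acts_by_mat bs M"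
  by (simp add: represented_in_def acts_by_mat_def)

lemma acts_by_mat_append:
  assumes "A \<in> carrier_mat (length as) (length as)" "B \<in> carrier_mat (length bs) (length bs)"
  shows "acts_by_mat (as @ bs) (four_block_mat A (0\<^sub>m (dim_row A) (dim_col B)) (0\<^sub>m (dim_row B) (dim_col A)) B)
    \<longleftrightarrow> acts_by_mat as A \<and> acts_by_mat bs B"
proof -
  let ?n = "length as" and ?k = "length bs"
  define M where "M = four_block_mat A (0\<^sub>m (dim_row A) (dim_col B)) (0\<^sub>m (dim_row B) (dim_col A)) B"
  have dims: "dim_row A = ?n" "dim_col A = ?n" "dim_row B = ?k" "dim_col B = ?k" using assms by auto
  have M: "M \<in> carrier_mat (?n + ?k) (?n + ?k)" unfolding M_def by (rule four_block_carrier_mat[OF assms])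
  have left: "(\<Sum>i<?n + ?k. M $$ (i, j) *s (as @ bs) ! i) = (\<Sum>i<?n. A $$ (i, j) *s as ! i)"
    if "j < ?n" for j
    using that by (simp add: M_def sum_lessThan_add dims nth_append)
  have right: "(\<Sum>i<?n + ?k. M $$ (i, ?n + j) *s (as @ bs) ! i) = (\<Sum>i<?k. B $$ (i, j) *s bs ! i)"
    if "j < ?k" for j
    using that by (simp add: M_def sum_lessThan_add dims nth_append)
  have "acts_by_mat (as @ bs) M \<longleftrightarrow>
    (\<forall>j<?n + ?k. u ((as @ bs) ! j) = (\<Sum>i<?n + ?k. M $$ (i, j) *s (as @ bs) ! i))"
    using M by (simp add: acts_by_mat_def)
  also have "\<dots> \<longleftrightarrow> (\<forall>j<?n. u (as ! j) = (\<Sum>i<?n. A $$ (i, j) *s as ! i)) \<and>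
      (\<forall>j<?k. u (bs ! j) = (\<Sum>i<?k. B $$ (i, j) *s bs ! i))"
    unfolding all_less_add using left right by (simp add: nth_append)
  also have "\<dots> \<longleftrightarrow> acts_by_mat as A \<and> acts_by_mat bs B"
    using assms by (simp add: acts_by_mat_def)
  finally show ?thesis by (simp add: M_def)
qed

lemma acts_by_diag_block_mat:
  assumes "\<And>A. A \<in> set As \<Longrightarrow> square_mat A"
  shows "acts_by_mat bs (diag_block_mat As) \<longleftrightarrow> (\<exists>bss. bs = concat bss \<and> list_all2 acts_by_mat bss As)"
  using assms
proof (induction As arbitrary: bs)
  case Nil
  have "acts_by_mat bs (0\<^sub>m 0 0) \<longleftrightarrow> bs = []" by (auto simp: acts_by_mat_def)
  then show ?case by simp
next
  case (Cons A As)
  let ?B = "diag_block_mat As"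
  have sq: "square_mat A" "square_mat ?B" using Cons.prems diag_block_mat_square[of As] by auto
  have split: "acts_by_mat (as @ bs) (diag_block_mat (A # As)) \<longleftrightarrow> acts_by_mat as A \<and> acts_by_mat bs ?B"
    if "length as = dim_row A" "length bs = dim_row ?B" for as bs
  proof -
    have "A \<in> carrier_mat (length as) (length as)" "?B \<in> carrier_mat (length bs) (length bs)"
      using that sq by (metis carrier_matI square_mat.simps)+
    moreover have "diag_block_mat (A # As) =
        four_block_mat A (0\<^sub>m (dim_row A) (dim_col ?B)) (0\<^sub>m (dim_row ?B) (dim_col A)) ?B"
      by (simp add: Let_def)
    ultimately show ?thesis using acts_by_mat_append by presburger
  qed
  show ?case
  proof
    assume L: "acts_by_mat bs (diag_block_mat (A # As))"
    then have len: "length bs = dim_row A + dim_row ?B" by (auto simp: acts_by_mat_def Let_def)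
    define as where "as = take (dim_row A) bs"
    define cs where "cs = drop (dim_row A) bs"
    have bs: "bs = as @ cs" by (simp add: as_def cs_def)
    have "acts_by_mat as A \<and> acts_by_mat cs ?B"
      using L split[of as cs] len by (simp add: bs[symmetric]) (simp add: as_def cs_def)
    moreover from this obtain bss where "cs = concat bss \<and> list_all2 acts_by_mat bss As"
      using Cons.IH[of cs] Cons.prems by auto
    ultimately show "\<exists>bss. bs = concat bss \<and> list_all2 acts_by_mat bss (A # As)"
      using bs by (intro exI[of _ "as # bss"]) simp
  next
    assume "\<exists>bss. bs = concat bss \<and> list_all2 acts_by_mat bss (A # As)"
    then obtain as bss where bss: "bs = as @ concat bss" "acts_by_mat as A" "list_all2 acts_by_mat bss As"
      by (auto simp: list_all2_Cons2)
    then have "acts_by_mat (concat bss) ?B" using Cons.IH[of "concat bss"] Cons.prems by auto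
    then show "acts_by_mat bs (diag_block_mat (A # As))"
      using split[of as "concat bss"] bss by (auto simp: acts_by_mat_def)
  qed
qed

lemma act_monic_eq:
  assumes "monic p"
  shows "act p v = (\<Sum>i<degree p. coeff p i *s (u ^^ i) v) + (u ^^ degree p) v"
  using assms by (simp add: poly_endo_def lessThan_Suc_atMost[symmetric])

text \<open>The subdiagonal ones force the list to consist of the iterates of its first vector, and
  the last column then expresses \<open>act p v = 0\<close>.\<close>

lemma acts_by_companion_mat:
  assumes "monic p"
  shows "acts_by_mat bs (companion_mat p) \<longleftrightarrow>
    (\<exists>v. bs = map (\<lambda>j. (u ^^ j) v) [0..<degree p] \<and> act p v = 0)"
proof (cases "degree p = 0")
  \<comment> \<open>In degree 0 the index \<open>degree p - 1\<close> of the last column is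
    truncated; here the matrix and the list are empty, and \<open>v = 0\<close> is the
    witness.\<close>
  case True
  then have "p = 1" using assms by (rule monic_degree_0[THEN iffD1, rotated])
  then show ?thesis by (auto simp: acts_by_mat_def companion_mat_def)
next
  case False
  let ?d = "degree p"
  have sum1: "(\<Sum>i<?d. companion_mat p $$ (i, j) *s w i) = w (Suc j)" if "Suc j < ?d" for j w
  proof -
    have "(\<Sum>i<?d. companion_mat p $$ (i, j) *s w i) = (\<Sum>i<?d. if i = Suc j then w i else 0)"
      by (rule sum.cong) (use that in \<open>auto simp: companion_mat_def\<close>)
    then show ?thesis using that by simp
  qed
  have sum2: "(\<Sum>i<?d. companion_mat p $$ (i, ?d - 1) *s w i) = - (\<Sum>i<?d. coeff p i *s w i)" for w
    using False by (simp add: companion_mat_def sum_negf)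
  have last: "u ((u ^^ (?d - 1)) v) = (u ^^ ?d) v" for v
    using False by (cases ?d) auto
  show ?thesis
  proof
    assume L: "acts_by_mat bs (companion_mat p)"
    then have len: "length bs = ?d" by (auto simp: acts_by_mat_def companion_mat_def)
    have L': "\<And>j. j < ?d \<Longrightarrow> u (bs ! j) = (\<Sum>i<?d. companion_mat p $$ (i, j) *s bs ! i)"
      using L len by (simp add: acts_by_mat_def)
    define v where "v = bs ! 0"
    have nth: "bs ! j = (u ^^ j) v" if "j < ?d" for j
      using that
    proof (induction j)
      case (Suc j)
      then show ?case using L'[of j] sum1[of j "(!) bs"] by simp
    qed (simp add: v_def)
    have "bs = map (\<lambda>j. (u ^^ j) v) [0..<?d]" by (rule nth_equalityI) (simp_all add: len nth)
    moreover have "act p v = 0"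
    proof -
      have "(u ^^ ?d) v = u (bs ! (?d - 1))" using False nth[of "?d - 1"] last by simp
      also have "\<dots> = - (\<Sum>i<?d. coeff p i *s bs ! i)" using L'[of "?d - 1"] sum2[of "(!) bs"] False by simp
      also have "(\<Sum>i<?d. coeff p i *s bs ! i) = (\<Sum>i<?d. coeff p i *s (u ^^ i) v)"
        by (rule sum.cong) (auto simp: nth)
      finally show ?thesis using assms by (simp add: act_monic_eq)
    qed
    ultimately show "\<exists>v. bs = map (\<lambda>j. (u ^^ j) v) [0..<?d] \<and> act p v = 0" by blast
  next
    assume "\<exists>v. bs = map (\<lambda>j. (u ^^ j) v) [0..<?d] \<and> act p v = 0"
    then obtain v where bs: "bs = map (\<lambda>j. (u ^^ j) v) [0..<?d]" and v: "act p v = 0" by blast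
    have "u ((u ^^ j) v) = (\<Sum>i<?d. companion_mat p $$ (i, j) *s (u ^^ i) v)" if j: "j < ?d" for j
    proof (cases "Suc j < ?d")
      case True
      then show ?thesis using sum1[of j "\<lambda>i. (u ^^ i) v"] by simp
    next
      case False
      then have j': "j = ?d - 1" using j by simp
      show ?thesis
        unfolding j' last sum2 using v assms by (simp add: act_monic_eq eq_neg_iff_add_eq_0 add.commute)
    qed
    then show "acts_by_mat bs (companion_mat p)"
      by (auto simp: acts_by_mat_def bs intro!: sum.cong)
  qed
qed

text \<open>The list is as long as the index set is large, so its distinctness amounts to
  injectivity of \<open>cyclic_vec\<close>.\<close>

lemma ordered_basis_cyclic_iff:
  "ordered_basis scale (concat (map (\<lambda>i. map (\<lambda>j. (u ^^ j) (vs i)) [0..<degree (ps i)]) [0..<m])) \<longleftrightarrow>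
    (inj_on (cyclic_vec vs) (cyclic_index m ps) \<and> independent (cyclic_vec vs ` cyclic_index m ps)) \<and>
    span (cyclic_vec vs ` cyclic_index m ps) = UNIV"
proof -
  let ?bs = "concat (map (\<lambda>i. map (\<lambda>j. (u ^^ j) (vs i)) [0..<degree (ps i)]) [0..<m])"
  have set: "set ?bs = cyclic_vec vs ` cyclic_index m ps"
  proof -
    have "set ?bs = (\<Union>i\<in>{..<m}. (\<lambda>j. cyclic_vec vs (i, j)) ` {..<degree (ps i)})"
      by (simp add: cyclic_vec_def atLeast0LessThan)
    also have "\<dots> = cyclic_vec vs ` cyclic_index m ps" unfolding cyclic_index_def by blast
    finally show ?thesis .
  qed
  have "length ?bs = (\<Sum>i<m. degree (ps i))"
    by (simp add: length_concat interv_sum_list_conv_sum_set_nat comp_def atLeast0LessThan)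
  then have len: "length ?bs = card (cyclic_index m ps)" by (simp add: card_cyclic_index)
  have "distinct ?bs \<longleftrightarrow> card (set ?bs) = length ?bs"
    using card_distinct distinct_card by blast
  also have "\<dots> \<longleftrightarrow> inj_on (cyclic_vec vs) (cyclic_index m ps)"
    unfolding set len using eq_card_imp_inj_on card_image finite_cyclic_index by blast
  finally show ?thesis unfolding ordered_basis_def set by blast
qed

text \<open>This translates between matrices and modules: a list on which the blocks act is a
  concatenation of chains of iterates, each starting in a vector killed by its \<open>ps i\<close>,
  and such a list is a basis precisely for a cyclic decomposition.\<close>

lemma represented_by_companions_iff:
  assumes monic: "\<And>i. i < m \<Longrightarrow> monic (ps i)"
  shows "represented_by scale u (diag_block_mat (map (\<lambda>i. companion_mat (ps i)) [0..<m])) \<longleftrightarrow>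
    (\<exists>vs. cyclic_decomp UNIV m ps vs)"
proof -
  let ?bss = "\<lambda>vs. map (\<lambda>i. map (\<lambda>j. (u ^^ j) (vs i)) [0..<degree (ps i)]) [0..<m]"
  let ?As = "map (\<lambda>i. companion_mat (ps i)) [0..<m]"
  have sq: "square_mat A" if "A \<in> set ?As" for A using that by (auto simp: companion_mat_def)
  have la: "list_all2 acts_by_mat bss ?As \<longleftrightarrow> (\<exists>vs. bss = ?bss vs \<and> (\<forall>i<m. act (ps i) (vs i) = 0))" for bss
  proof
    assume "list_all2 acts_by_mat bss ?As"
    then have len: "length bss = m" and "\<And>i. i < m \<Longrightarrow> acts_by_mat (bss ! i) (companion_mat (ps i))"
      by (auto simp: list_all2_conv_all_nth)
    then have "\<forall>i. \<exists>v. i < m \<longrightarrow> bss ! i = map (\<lambda>j. (u ^^ j) v) [0..<degree (ps i)] \<and> act (ps i) v = 0"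
      using acts_by_companion_mat[OF monic] by blast
    then obtain vs where vs: "\<forall>i. i < m \<longrightarrow> bss ! i = map (\<lambda>j. (u ^^ j) (vs i)) [0..<degree (ps i)] \<and> act (ps i) (vs i) = 0"
      by metis
    then have "bss = ?bss vs" using len by (intro nth_equalityI) auto
    then show "\<exists>vs. bss = ?bss vs \<and> (\<forall>i<m. act (ps i) (vs i) = 0)" using vs by blast
  next
    assume "\<exists>vs. bss = ?bss vs \<and> (\<forall>i<m. act (ps i) (vs i) = 0)"
    then obtain vs where vs: "bss = ?bss vs" "\<And>i. i < m \<Longrightarrow> act (ps i) (vs i) = 0" by blast
    have "acts_by_mat (map (\<lambda>j. (u ^^ j) (vs i)) [0..<degree (ps i)]) (companion_mat (ps i))"
      if "i < m" for i
      using acts_by_companion_mat[OF monic[OF that]] vs(2)[OF that] by blast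
    then show "list_all2 acts_by_mat bss ?As" by (simp add: list_all2_conv_all_nth vs(1))
  qed
  have acts: "acts_by_mat bs (diag_block_mat ?As) \<longleftrightarrow>
      (\<exists>vs. bs = concat (?bss vs) \<and> (\<forall>i<m. act (ps i) (vs i) = 0))" for bs
    using acts_by_diag_block_mat[of ?As bs] sq unfolding la by blast
  have "represented_by scale u (diag_block_mat ?As) \<longleftrightarrow>
    (\<exists>vs. ordered_basis scale (concat (?bss vs)) \<and> (\<forall>i<m. act (ps i) (vs i) = 0))"
    unfolding represented_by_def represented_in_iff acts by blast
  also have "\<dots> \<longleftrightarrow> (\<exists>vs. (\<forall>i<m. act (ps i) (vs i) = 0) \<and> cyclic_decomp UNIV m ps vs)"
    unfolding ordered_basis_cyclic_iff using cyclic_decomp_iff_basis[of m ps _ UNIV] monic by blast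
  also have "\<dots> \<longleftrightarrow> (\<exists>vs. cyclic_decomp UNIV m ps vs)"
    by (auto simp: cyclic_decomp_def)
  finally show ?thesis .
qed

end

text \<open>Flattens the nested blocks of condition (iii): the two copies in block \<open>k\<close>
  take the positions \<open>2 * k\<close> and \<open>2 * k + 1\<close>.\<close>

lemma diag_block_mat_pairs:
  "diag_block_mat (map (\<lambda>k. diag_block_mat [A k, A k]) [0..<m]) =
    diag_block_mat (map (\<lambda>i. A (i div 2)) [0..<2 * m])"
proof (induction m)
  case (Suc m)
  have *: "[0..<2 * Suc m] = [0..<2 * m] @ [2 * m, Suc (2 * m)]" by simp
  have "diag_block_mat (map (\<lambda>i. A (i div 2)) [0..<2 * Suc m]) =
      diag_block_mat (map (\<lambda>i. A (i div 2)) [0..<2 * m] @ [A m, A m])"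
    unfolding * by simp
  then show ?case
    by (simp add: diag_block_mat_append[of _ "[A m, A m]"] diag_block_mat_last Suc.IH Let_def del: diag_block_mat.simps)
qed simp

lemma card_div2: "card {i. i < 2 * m \<and> P (i div 2)} = 2 * card {k. k < m \<and> P k}" for m :: nat
proof (induction m)
  case (Suc m)
  have "{i. i < 2 * Suc m \<and> P (i div 2)} =
      {i. i < 2 * m \<and> P (i div 2)} \<union> (if P m then {2 * m, 2 * m + 1} else {})"
    by (auto simp: less_Suc_eq)
  moreover have "{k. k < Suc m \<and> P k} = {k. k < m \<and> P k} \<union> (if P m then {m} else {})"
    by (auto simp: less_Suc_eq)
  ultimately show ?case using Suc by (auto simp: card_Un_disjoint)
qed simp

section \<open>Exponents, socle dimensions and pairing\<close>

context fin_dim_endo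
begin

definition socle_dim :: "'a poly \<Rightarrow> nat \<Rightarrow> nat" where
  "socle_dim r j = dim {v \<in> range (act (r ^ j)). act r v = 0}"

lemma socle_dim_eq:
  assumes "irreducible r" "monic r" "cyclic_decomp UNIV m (\<lambda>i. r ^ n i) vs"
  shows "socle_dim r j = degree r * card {i. i < m \<and> j < n i}"
  using dim_socle[OF assms] by (simp add: socle_dim_def)

text \<open>For decreasing exponents the indices with \<open>j < n i\<close> form an initial
  segment. Its length \<open>c\<close> is a part of the conjugate partition, and it is read off from
  a dimension that depends on \<open>u\<close> alone.\<close>

lemma exponent_iff:
  assumes r: "irreducible r" "monic r" and dec: "cyclic_decomp UNIV m (\<lambda>i. r ^ n i) vs"
    and anti: "\<And>i. n (Suc i) \<le> n i" and zero: "\<And>i. m \<le> i \<Longrightarrow> n i = 0"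
  shows "\<exists>c. socle_dim r j = degree r * c \<and> (\<forall>i. j < n i \<longleftrightarrow> i < c)"
proof -
  have decr: "n k \<le> n i" if "i \<le> k" for i k
    using that anti by (rule lift_Suc_antimono_le[rotated])
  define c where "c = (LEAST i. n i \<le> j)"
  have c: "n c \<le> j" unfolding c_def by (rule LeastI[of _ m]) (simp add: zero)
  have iff: "j < n i \<longleftrightarrow> i < c" for i
    using not_less_Least[of i "\<lambda>i. n i \<le> j"] decr[of c i] c by (force simp: c_def not_le)
  have "c \<le> m" unfolding c_def by (rule Least_le) (simp add: zero)
  then have "i < m \<and> j < n i \<longleftrightarrow> i < c" for i unfolding iff by auto
  then have "{i. i < m \<and> j < n i} = {..<c}" by blast
  then have "socle_dim r j = degree r * c" using socle_dim_eq[OF r dec, of j] by simp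
  then show ?thesis using iff by blast
qed

lemma invariant_factors_exponents:
  assumes r: "irreducible r" "monic r" and ann: "annihilates scale (r ^ N) u"
    and inv: "is_invariant_factors scale u rs"
  shows "\<exists>n. rs = (\<lambda>i. r ^ n i) \<and>
    (\<forall>j. \<exists>c. socle_dim r j = degree r * c \<and> (\<forall>i. j < n i \<longleftrightarrow> i < c))"
proof -
  obtain m where m: "\<And>i. m \<le> i \<Longrightarrow> rs i = 1"
    and "represented_by scale u (diag_block_mat (map (\<lambda>i. companion_mat (rs i)) [0..<m]))"
    using inv by (auto simp: is_invariant_factors_def)
  then obtain vs where dec: "cyclic_decomp UNIV m rs vs"
    using represented_by_companions_iff[of m rs] inv by (auto simp: is_invariant_factors_def)
  have "\<exists>k. rs i = r ^ k" for i
  proof (cases "i < m")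
    case True
    \<comment> \<open>Since \<open>r ^ N\<close> kills the sum of all generators, independence of
      the summands makes every \<open>rs i\<close> divide it.\<close>
    have "comb m vs (\<lambda>_. r ^ N) = act (r ^ N) (comb m vs (\<lambda>_. 1))" by (simp add: act_comb)
    then have "\<forall>i<m. rs i dvd r ^ N"
      using ann by (simp add: annihilates_def flip: comb_eq_0_iff[OF dec])
    then show ?thesis
      using monic_dvd_irreducible_power[OF r, of "rs i" N] True inv by (auto simp: is_invariant_factors_def)
  qed (use m in \<open>auto intro: exI[of _ 0]\<close>)
  then obtain n where n: "rs = (\<lambda>i. r ^ n i)" by metis
  have dr: "degree r > 0" using r(1) by (rule irreducible_poly_degree_pos)
  have r0: "r \<noteq> 0" using r(1) by auto
  then have deg: "degree (r ^ k) = k * degree r" for k by (simp add: degree_power_eq)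
  have "r ^ n (Suc i) dvd r ^ n i" for i using inv by (simp add: is_invariant_factors_def n)
  then have "degree (r ^ n (Suc i)) \<le> degree (r ^ n i)" for i
    using r0 by (intro dvd_imp_degree_le) auto
  then have anti: "n (Suc i) \<le> n i" for i using dr by (simp add: deg)
  have zero: "n i = 0" if "m \<le> i" for i using m[OF that] deg[of "n i"] dr by (simp add: n)
  show ?thesis
    using exponent_iff[where r = r and m = m and n = n and vs = vs] r dec n anti zero by blast
qed

lemma exists_invariant_factors:
  assumes r: "irreducible r" "monic r" and ann: "annihilates scale (r ^ N) u"
  shows "\<exists>rs. is_invariant_factors scale u rs"
proof -
  obtain m n vs where n: "\<forall>i<m. 1 \<le> n i" "\<forall>i j. i \<le> j \<longrightarrow> j < m \<longrightarrow> n j \<le> n i"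
    and dec: "cyclic_decomp UNIV m (\<lambda>i. r ^ n i) vs"
    using primary_cyclic_decomp[OF r invariant_UNIV, of N] ann by (auto simp: annihilates_def)
  define rs where "rs i = (if i < m then r ^ n i else 1)" for i
  have monic: "monic (rs i)" for i using r by (simp add: rs_def monic_power)
  have "cyclic_decomp UNIV m rs vs" using dec by (simp add: cyclic_decomp_def rs_def)
  then have "represented_by scale u (diag_block_mat (map (\<lambda>i. companion_mat (rs i)) [0..<m]))"
    using represented_by_companions_iff[of m rs] monic by blast
  moreover have "rs (Suc i) dvd rs i" for i
    using n(2) by (auto simp: rs_def intro!: le_imp_power_dvd)
  ultimately have "is_invariant_factors scale u rs"
    unfolding is_invariant_factors_def using monic by (auto simp: rs_def intro!: exI[of _ m])
  then show ?thesis by blast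
qed

text \<open>Two sequences of invariant factors have the same conjugate partition, given by the socle
  dimensions, and hence agree. This uniqueness resolves the definite description in
  \<open>invariant_factor\<close>; the shift \<open>k - 1\<close> is its numbering from 1.\<close>

lemma invariant_factor_primary:
  assumes r: "irreducible r" "monic r" and ann: "annihilates scale (r ^ N) u"
  shows "\<exists>n. (\<forall>k. invariant_factor scale u k = r ^ n (k - 1)) \<and>
    (\<forall>j. \<exists>c. socle_dim r j = degree r * c \<and> (\<forall>i. j < n i \<longleftrightarrow> i < c))"
proof -
  obtain rs where rs: "is_invariant_factors scale u rs" using exists_invariant_factors[OF assms] by blast
  obtain n where n: "rs = (\<lambda>i. r ^ n i)"
    and c: "\<forall>j. \<exists>c. socle_dim r j = degree r * c \<and> (\<forall>i. j < n i \<longleftrightarrow> i < c)"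
    using invariant_factors_exponents[OF assms rs] by blast
  have uniq: "rs' = rs" if rs': "is_invariant_factors scale u rs'" for rs'
  proof -
    obtain n' where n': "rs' = (\<lambda>i. r ^ n' i)"
      and c': "\<forall>j. \<exists>c. socle_dim r j = degree r * c \<and> (\<forall>i. j < n' i \<longleftrightarrow> i < c)"
      using invariant_factors_exponents[OF assms rs'] by blast
    have "j < n' i \<longleftrightarrow> j < n i" for i j
    proof -
      obtain d where d: "socle_dim r j = degree r * d" "\<forall>i. j < n i \<longleftrightarrow> i < d" using c by blast
      obtain d' where d': "socle_dim r j = degree r * d'" "\<forall>i. j < n' i \<longleftrightarrow> i < d'" using c' by blast
      have "d = d'" using d(1) d'(1) irreducible_poly_degree_pos[OF r(1)] by simp
      then show ?thesis using d(2) d'(2) by simp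
    qed
    then have "n' i = n i" for i by (metis linorder_neqE_nat less_irrefl)
    then show ?thesis using n n' by simp
  qed
  have "(THE rs. is_invariant_factors scale u rs) = rs" using rs uniq by (rule the_equality)
  then show ?thesis using n c by (auto simp: invariant_factor_def)
qed

text \<open>The exponents at \<open>2 * k\<close> and \<open>2 * k + 1\<close> agree for all
  \<open>k\<close> when no initial segment \<open>{i. i < c j}\<close> separates these two indices,
  that is, when every \<open>c j\<close> is even.\<close>

lemma invariant_factors_paired_iff:
  assumes r: "irreducible r" "monic r" and ann: "annihilates scale (r ^ N) u"
  shows "(\<forall>k\<ge>1. invariant_factor scale u (2 * k - 1) = invariant_factor scale u (2 * k)) \<longleftrightarrow>
    (\<forall>j. 2 * degree r dvd socle_dim r j)"
proof -
  obtain n where n: "\<And>k. invariant_factor scale u k = r ^ n (k - 1)"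
    and c: "\<And>j. \<exists>c. socle_dim r j = degree r * c \<and> (\<forall>i. j < n i \<longleftrightarrow> i < c)"
    using invariant_factor_primary[OF assms] by blast
  obtain c where c: "\<And>j. socle_dim r j = degree r * c j" "\<And>i j. j < n i \<longleftrightarrow> i < c j"
    using c by metis
  have dr: "degree r > 0" using r(1) by (rule irreducible_poly_degree_pos)
  have inj: "r ^ a = r ^ b \<longleftrightarrow> a = b" for a b
  proof -
    have "degree (r ^ a) = a * degree r" "degree (r ^ b) = b * degree r"
      using r by (auto simp: degree_power_eq)
    then show ?thesis using dr by (metis mult_right_cancel neq0_conv)
  qed
  have "(\<forall>k\<ge>1. invariant_factor scale u (2 * k - 1) = invariant_factor scale u (2 * k)) \<longleftrightarrow>
    (\<forall>k\<ge>1. n (2 * k - 2) = n (2 * k - 1))"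
    by (simp add: n inj numeral_2_eq_2)
  also have "\<dots> \<longleftrightarrow> (\<forall>k. n (2 * k) = n (2 * k + 1))"
  proof safe
    fix k assume "\<forall>k\<ge>1. n (2 * k - 2) = n (2 * k - 1)"
    from spec[OF this, of "Suc k"] show "n (2 * k) = n (2 * k + 1)" by simp
  next
    fix k :: nat assume *: "\<forall>k. n (2 * k) = n (2 * k + 1)" and "1 \<le> k"
    then obtain l where "k = Suc l" by (cases k) auto
    then show "n (2 * k - 2) = n (2 * k - 1)" using spec[OF *, of l] by simp
  qed
  also have "\<dots> \<longleftrightarrow> (\<forall>k j. 2 * k < c j \<longleftrightarrow> 2 * k + 1 < c j)"
    by (simp flip: c(2)) (metis less_irrefl linorder_neqE_nat)
  also have "\<dots> \<longleftrightarrow> (\<forall>j. even (c j))"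
  proof safe
    fix j assume *: "\<forall>k j. 2 * k < c j \<longleftrightarrow> 2 * k + 1 < c j"
    show "even (c j)"
    proof (rule ccontr)
      assume "odd (c j)"
      then obtain k where "c j = 2 * k + 1" by (elim oddE)
      then show False using *[rule_format, of k j] by simp
    qed
  next
    fix k j assume "\<forall>j. even (c j)" "2 * k < c j"
    then have "even (c j)" by blast
    with \<open>2 * k < c j\<close> show "2 * k + 1 < c j" by presburger
  qed auto
  also have "\<dots> \<longleftrightarrow> (\<forall>j. 2 * degree r dvd socle_dim r j)"
    using dr by (simp add: c(1) mult.commute[of 2])
  finally show ?thesis .
qed

lemma paired_decomp_iff:
  assumes r: "irreducible r" "monic r"
  shows "(\<exists>m \<nu> vs. (\<forall>k<m. \<nu> k > 0) \<and> cyclic_decomp UNIV (2 * m) (\<lambda>i. r ^ \<nu> (i div 2)) vs) \<longleftrightarrow>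
    (\<exists>N. annihilates scale (r ^ N) u) \<and> (\<forall>j. 2 * degree r dvd socle_dim r j)"
proof safe
  fix m \<nu> vs assume dec: "cyclic_decomp UNIV (2 * m) (\<lambda>i. r ^ \<nu> (i div 2)) vs"
  show "2 * degree r dvd socle_dim r j" for j
    unfolding socle_dim_eq[OF r dec] card_div2[of m "\<lambda>k. j < \<nu> k"] by simp
  \<comment> \<open>The sum serves only as a common upper bound of the exponents.\<close>
  have "act (r ^ (\<Sum>k<m. \<nu> k)) v = 0" for v
  proof -
    have "v \<in> range (comb (2 * m) vs)" using dec by (simp add: cyclic_decomp_def)
    then obtain f where v: "v = comb (2 * m) vs f" by blast
    have "\<nu> k \<le> (\<Sum>k<m. \<nu> k)" if "k < m" for k using that by (intro member_le_sum) auto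
    then show ?thesis
      unfolding v act_comb comb_eq_0_iff[OF dec] by (auto intro!: dvd_mult2 le_imp_power_dvd)
  qed
  then show "\<exists>N. annihilates scale (r ^ N) u" by (auto simp: annihilates_def)
next
  fix N assume ann: "annihilates scale (r ^ N) u" and div: "\<forall>j. 2 * degree r dvd socle_dim r j"
  obtain m n vs where n: "\<forall>i<m. 1 \<le> n i" "\<forall>i j. i \<le> j \<longrightarrow> j < m \<longrightarrow> n j \<le> n i"
    and dec: "cyclic_decomp UNIV m (\<lambda>i. r ^ n i) vs"
    using primary_cyclic_decomp[OF r invariant_UNIV, of N] ann by (auto simp: annihilates_def)
  have dr: "degree r > 0" using r(1) by (rule irreducible_poly_degree_pos)
  have even: "even (card {i. i < m \<and> j < n i})" for j
    using spec[OF div, of j] dr by (simp add: socle_dim_eq[OF r dec] mult.commute[of 2])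
  have "{i. i < m \<and> 0 < n i} = {..<m}" using n(1) by force
  then have "even m" using even[of 0] by simp
  then obtain m' where m': "m = 2 * m'" by (elim evenE)
  have pair: "n (2 * k + 1) = n (2 * k)" if k: "k < m'" for k
  proof (rule ccontr)
    assume "n (2 * k + 1) \<noteq> n (2 * k)"
    then have less: "n (2 * k + 1) < n (2 * k)"
      using n(2)[rule_format, of "2 * k" "2 * k + 1"] k m' by simp
    \<comment> \<open>If the exponent drops inside a pair, counting the exponents above the lower
      value gives \<open>2 * k + 1\<close>, an odd number.\<close>
    have "{i. i < m \<and> n (2 * k + 1) < n i} = {..2 * k}"
    proof (intro equalityI subsetI)
      fix i assume i: "i \<in> {i. i < m \<and> n (2 * k + 1) < n i}"
      show "i \<in> {..2 * k}"
      proof (rule ccontr)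
        assume "i \<notin> {..2 * k}"
        then have "n i \<le> n (2 * k + 1)" using n(2) i by simp
        then show False using i by simp
      qed
    next
      fix i assume i: "i \<in> {..2 * k}"
      have "2 * k < m" using k m' by simp
      then have "n (2 * k) \<le> n i" using n(2) i by simp
      then show "i \<in> {i. i < m \<and> n (2 * k + 1) < n i}" using less i \<open>2 * k < m\<close> by simp
    qed
    then show False using even[of "n (2 * k + 1)"] by simp
  qed
  define \<nu> where "\<nu> k = n (2 * k)" for k
  have eq: "n i = \<nu> (i div 2)" if "i < m" for i
  proof (cases "even i")
    case False
    then obtain k where k: "i = 2 * k + 1" by (elim oddE)
    then show ?thesis using pair[of k] that m' by (simp add: \<nu>_def)
  qed (simp add: \<nu>_def)
  have "cyclic_decomp UNIV (2 * m') (\<lambda>i. r ^ \<nu> (i div 2)) vs"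
    using dec eq by (simp add: cyclic_decomp_def m')
  moreover have "\<forall>k<m'. \<nu> k > 0" using n(1) m' by (auto simp: \<nu>_def Suc_le_eq)
  ultimately show "\<exists>m \<nu> vs. (\<forall>k<m. \<nu> k > 0) \<and> cyclic_decomp UNIV (2 * m) (\<lambda>i. r ^ \<nu> (i div 2)) vs" by blast
qed

lemma represented_by_pairs_iff:
  assumes r: "irreducible r" "monic r"
  shows "(\<exists>Bs. (\<forall>B\<in>set Bs. \<exists>n>0. B = diag_block_mat [companion_mat (r ^ n), companion_mat (r ^ n)]) \<and>
          represented_by scale u (diag_block_mat Bs)) \<longleftrightarrow>
    (\<exists>m \<nu> vs. (\<forall>k<m. \<nu> k > 0) \<and> cyclic_decomp UNIV (2 * m) (\<lambda>i. r ^ \<nu> (i div 2)) vs)"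
proof -
  let ?B = "\<lambda>n. diag_block_mat [companion_mat (r ^ n), companion_mat (r ^ n)]"
  have rep: "represented_by scale u (diag_block_mat (map (\<lambda>k. ?B (\<nu> k)) [0..<m])) \<longleftrightarrow>
      (\<exists>vs. cyclic_decomp UNIV (2 * m) (\<lambda>i. r ^ \<nu> (i div 2)) vs)" for m \<nu>
    unfolding diag_block_mat_pairs[of "\<lambda>k. companion_mat (r ^ \<nu> k)"]
    by (rule represented_by_companions_iff) (rule monic_power[OF r(2)])
  show ?thesis
  proof
    assume "\<exists>Bs. (\<forall>B\<in>set Bs. \<exists>n>0. B = ?B n) \<and> represented_by scale u (diag_block_mat Bs)"
    then obtain Bs where Bs: "\<forall>B\<in>set Bs. \<exists>n>0. B = ?B n" "represented_by scale u (diag_block_mat Bs)"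
      by blast
    then have "\<forall>k. \<exists>n. k < length Bs \<longrightarrow> n > 0 \<and> Bs ! k = ?B n" by (meson nth_mem)
    then obtain \<nu> where \<nu>: "\<forall>k. k < length Bs \<longrightarrow> \<nu> k > 0 \<and> Bs ! k = ?B (\<nu> k)" by metis
    then have "Bs = map (\<lambda>k. ?B (\<nu> k)) [0..<length Bs]" by (intro nth_equalityI) (auto simp del: diag_block_mat.simps)
    then show "\<exists>m \<nu> vs. (\<forall>k<m. \<nu> k > 0) \<and> cyclic_decomp UNIV (2 * m) (\<lambda>i. r ^ \<nu> (i div 2)) vs"
      using Bs(2) rep[of \<nu> "length Bs"] \<nu> by metis
  next
    assume "\<exists>m \<nu> vs. (\<forall>k<m. \<nu> k > 0) \<and> cyclic_decomp UNIV (2 * m) (\<lambda>i. r ^ \<nu> (i div 2)) vs"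
    then obtain m \<nu> where "\<forall>k<m. \<nu> k > 0" "represented_by scale u (diag_block_mat (map (\<lambda>k. ?B (\<nu> k)) [0..<m]))"
      using rep by blast
    then show "\<exists>Bs. (\<forall>B\<in>set Bs. \<exists>n>0. B = ?B n) \<and> represented_by scale u (diag_block_mat Bs)"
      by (intro exI[of _ "map (\<lambda>k. ?B (\<nu> k)) [0..<m]"]) (auto simp del: diag_block_mat.simps)
  qed
qed

lemma minimal_poly_eq_power_iff:
  assumes "irreducible r" "monic r"
  shows "(\<exists>n. minimal_poly scale u = r ^ n) \<longleftrightarrow> (\<exists>n. annihilates scale (r ^ n) u)"
proof
  show "\<exists>n. minimal_poly scale u = r ^ n \<Longrightarrow> \<exists>n. annihilates scale (r ^ n) u"
    using minimal_poly_props(2) by metis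
next
  assume "\<exists>n. annihilates scale (r ^ n) u"
  then obtain n where "minimal_poly scale u dvd r ^ n" using minimal_poly_props(3) by blast
  then show "\<exists>n. minimal_poly scale u = r ^ n"
    using monic_dvd_irreducible_power[OF assms minimal_poly_props(1)] by blast
qed

end

section \<open>Quadratic polynomials\<close>

lemma irreducible_degree_2_no_root:
  fixes p :: "'a::field poly"
  assumes "irreducible p" "degree p = 2"
  shows "poly p c \<noteq> 0"
proof
  assume "poly p c = 0"
  then have "[:- c, 1:] dvd p" by (simp add: poly_eq_0_iff_dvd)
  then obtain g where g: "p = [:- c, 1:] * g" by (elim dvdE)
  have "\<not> is_unit [:- c, 1:]" by (simp add: is_unit_pCons_iff)
  then have "is_unit g" using irreducibleD[OF assms(1) g] by blast
  then have "g \<noteq> 0" "degree g = 0" by (auto simp: is_unit_iff_degree)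
  then have "degree p = 1" unfolding g by (subst degree_mult_eq) auto
  then show False using assms(2) by simp
qed

lemma degree_le_1_eq: "degree p \<le> 1 \<Longrightarrow> p = [:coeff p 0, coeff p 1:]"
  by (rule poly_eqI) (auto simp: coeff_pCons coeff_eq_0 split: nat.split)

lemma irreducible_degree_2I:
  fixes p :: "'a::field poly"
  assumes "degree p = 2" "\<And>c. poly p c \<noteq> 0"
  shows "irreducible p"
proof (rule irreducibleI)
  show "p \<noteq> 0" using assms(1) by auto
  then show "\<not> is_unit p" using assms(1) by (simp add: is_unit_iff_degree)
  fix f g assume p: "p = f * g"
  have nz: "f \<noteq> 0" "g \<noteq> 0" using p \<open>p \<noteq> 0\<close> by auto
  have no1: "degree h \<noteq> 1" if "h dvd p" for h
  proof
    assume "degree h = 1"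
    then obtain c d where h: "h = [:c, d:]" using degree_le_1_eq[of h] by auto
    then have "poly h (- c / d) = 0" using \<open>degree h = 1\<close> by (simp split: if_splits)
    then show False using that assms(2) by (metis dvdE mult_zero_left poly_mult)
  qed
  have "degree f + degree g = 2" using nz assms(1) by (simp add: p degree_mult_eq)
  moreover have "degree f \<noteq> 1" "degree g \<noteq> 1" using no1 p by auto
  ultimately have "degree f = 0 \<or> degree g = 0" by linarith
  then show "is_unit f \<or> is_unit g" using nz by (simp add: is_unit_iff_degree)
qed

lemma monic_degree_2_eq:
  assumes "monic p" "degree p = 2"
  shows "p = [:coeff p 0, coeff p 1, 1:]"
proof (rule poly_eqI)
  fix i :: nat
  consider "i = 0" | "i = 1" | "i = 2" | "i > 2" by linarith
  then show "coeff p i = coeff [:coeff p 0, coeff p 1, 1:] i"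
    using assms by cases (auto simp: numeral_2_eq_2 coeff_eq_0 coeff_pCons split: nat.split)
qed

section \<open>Roots, discriminants and splitting fields of quadratics\<close>

lemma Root_quadratic: "Root [:a, l, 1:] = {x. x\<^sup>2 + to_ac l * x + to_ac a = 0}"
  by (simp add: Root_def map_poly_pCons power2_eq_square algebra_simps)

lemma Root_nonempty: "\<exists>x. x \<in> Root [:a, l, 1:]"
  using alg_closed_imp_poly_has_root[of "map_poly to_ac [:a, l, 1:]"]
  by (auto simp: Root_def map_poly_pCons)

text \<open>By Vieta, \<open>(x - y)^2\<close> depends only on the coefficients, so every
  factorization gives the same value. One exists: for a root \<open>x\<close> the second root is
  \<open>- l - x\<close>.\<close>

lemma discr_quadratic: "discr [:a, l, 1:] = to_ac (l\<^sup>2 - 4 * a)"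
proof -
  have map: "map_poly to_ac [:a, l, 1:] = [:to_ac a, to_ac l, 1:]" by (simp add: map_poly_pCons)
  have prod: "[:- x, 1:] * [:- y, 1:] = [:x * y, - x - y, 1:]" for x y :: "'a alg_closure" by simp
  have disc: "(- x - y)\<^sup>2 - 4 * (x * y) = (x - y)\<^sup>2" for x y :: "'a alg_closure"
    by (simp add: power2_eq_square algebra_simps)
  have ac: "to_ac (l\<^sup>2 - 4 * a) = (to_ac l)\<^sup>2 - 4 * to_ac a" by simp
  obtain x where "x \<in> Root [:a, l, 1:]" using Root_nonempty by blast
  then have x: "x\<^sup>2 + to_ac l * x + to_ac a = 0" by (simp add: Root_quadratic)
  define y where "y = - to_ac l - x"
  have "to_ac a = x * y" using x by (simp add: y_def algebra_simps power2_eq_square eq_neg_iff_add_eq_0)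
  moreover have "to_ac l = - x - y" by (simp add: y_def)
  ultimately have ex: "\<exists>x1 x2. map_poly to_ac [:a, l, 1:] = [:- x1, 1:] * [:- x2, 1:] \<and>
      to_ac (l\<^sup>2 - 4 * a) = (x1 - x2)\<^sup>2"
    using disc[of x y] unfolding ac map prod by (intro exI[of _ x] exI[of _ y]) (simp only: simp_thms)
  have "d = to_ac (l\<^sup>2 - 4 * a)"
    if d: "\<exists>x1 x2. map_poly to_ac [:a, l, 1:] = [:- x1, 1:] * [:- x2, 1:] \<and> d = (x1 - x2)\<^sup>2" for d
  proof -
    obtain x1 x2 where "[:to_ac a, to_ac l, 1:] = [:x1 * x2, - x1 - x2, 1:]" "d = (x1 - x2)\<^sup>2"
      using d unfolding map prod by blast
    then show ?thesis using disc[of x1 x2] unfolding ac by (simp only: pCons_eq_iff)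
  qed
  with ex show ?thesis unfolding discr_def by (rule the_equality)
qed

lemma splitting_field_subset:
  assumes "\<And>y. y \<in> Root q \<Longrightarrow> \<exists>x\<in>Root p. \<exists>c d. y = to_ac c + to_ac d * x"
  shows "splitting_field q \<subseteq> splitting_field p"
proof
  let ?R = "ring_of_type_algebra :: 'a alg_closure ring"
  fix z assume "z \<in> splitting_field q"
  then have "z \<in> generate_field ?R (range to_ac \<union> Root q)" by (simp add: splitting_field_def)
  then have "z \<in> generate_field ?R (range to_ac \<union> Root p)"
  proof induction
    case (incl h)
    then consider "h \<in> range to_ac" | "h \<in> Root q" by blast
    then show ?case
    proof cases
      case 2
      then obtain x c d where "x \<in> Root p" "h = to_ac c + to_ac d * x" using assms by blast
      then have "h = to_ac c \<oplus>\<^bsub>?R\<^esub> (to_ac d \<otimes>\<^bsub>?R\<^esub> x)" "x \<in> Root p"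
        by (simp_all add: ring_of_type_algebra_def)
      then show ?thesis
        using generate_field.eng_add generate_field.eng_mult generate_field.incl
        by (metis UnI1 UnI2 rangeI)
    qed (simp add: generate_field.incl)
  qed (auto intro: generate_field.intros)
  then show "z \<in> splitting_field p" by (simp add: splitting_field_def)
qed

text \<open>For a root \<open>x\<close>, the element \<open>2 * x + l\<close> is a square root of
  the discriminant. Equal discriminants make these elements agree up to sign for both polynomials;
  if 2 is invertible, each root is then an affine expression in a root of the other polynomial, and
  the splitting fields coincide.\<close>

lemma same_discr_distinct_splitting_char_2:
  fixes a b l k :: "'a::field"
  assumes "splitting_field [:a, l, 1:] \<noteq> splitting_field [:b, k, 1:]"
    and "discr [:a, l, 1:] = discr [:b, k, 1:]"
  shows "(2 :: 'a) = 0"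
proof (rule ccontr)
  assume two: "(2 :: 'a) \<noteq> 0"
  have sub: "splitting_field [:b, k, 1:] \<subseteq> splitting_field [:a, l, 1:]"
    if disc: "l\<^sup>2 - 4 * a = k\<^sup>2 - 4 * b" for a b l k :: 'a
  proof (rule splitting_field_subset)
    fix y assume y: "y \<in> Root [:b, k, 1:]"
    obtain x where x: "x \<in> Root [:a, l, 1:]" using Root_nonempty by blast
    have disc_root: "(2 * z + to_ac m)\<^sup>2 = to_ac (m\<^sup>2 - 4 * c)" if "z \<in> Root [:c, m, 1:]" for z c m
    proof -
      have z: "z\<^sup>2 + to_ac m * z + to_ac c = 0" using that by (simp add: Root_quadratic)
      have "(2 * z + to_ac m)\<^sup>2 = to_ac (m\<^sup>2 - 4 * c) + 4 * (z\<^sup>2 + to_ac m * z + to_ac c)"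
        by (simp add: power2_eq_square algebra_simps)
      then show ?thesis unfolding z by simp
    qed
    have "(2 * y + to_ac k)\<^sup>2 = (2 * x + to_ac l)\<^sup>2"
      unfolding disc_root[OF x] disc_root[OF y] disc ..
    then have "2 * y + to_ac k = 2 * x + to_ac l \<or> 2 * y + to_ac k = - (2 * x + to_ac l)"
      by (simp add: power2_eq_iff)
    moreover have two': "(2 :: 'a alg_closure) \<noteq> 0" using two by (metis to_ac_eq_0_iff to_ac_numeral)
    ultimately have "y = to_ac ((l - k) / 2) + to_ac 1 * x \<or> y = to_ac ((- l - k) / 2) + to_ac (- 1) * x"
      by (auto simp: to_ac_divide to_ac_diff to_ac_minus field_simps)
    then show "\<exists>x\<in>Root [:a, l, 1:]. \<exists>c d. y = to_ac c + to_ac d * x" using x by blast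
  qed
  have "l\<^sup>2 - 4 * a = k\<^sup>2 - 4 * b" using assms(2) by (simp only: discr_quadratic to_ac_eq_iff)
  then show False using sub[of l a k b] sub[of k b l a] assms(1) by auto
qed

section \<open>Two quadratics with equal trace in characteristic 2\<close>

locale char_2_pair =
  fixes p q r :: "'a::field poly" and a b l :: 'a
  assumes two: "(2 :: 'a) = 0" and l: "l \<noteq> 0"
    and p: "p = [:a, l, 1:]" and q: "q = [:b, l, 1:]" and r: "r = [:a + b, l, 1:]"
    and irr: "irreducible p" "irreducible q" "irreducible r"

text \<open>The discriminant is the square of the middle coefficient, and squaring is injective in
  characteristic 2, so both middle coefficients equal one \<open>l\<close>, which is nonzero. A root
  \<open>c\<close> of \<open>r\<close> in the base field would make \<open>x + c\<close> a root of
  \<open>q\<close> for each root \<open>x\<close> of \<open>p\<close> and conversely, forcing equal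
  splitting fields; hence \<open>r\<close> is irreducible.\<close>

lemma char_2_pairI:
  fixes p q r :: "'a::field poly"
  assumes "monic p" "degree p = 2" "irreducible p"
    and "monic q" "degree q = 2" "irreducible q"
    and "splitting_field p \<noteq> splitting_field q"
    and "discr p = discr q" "discr p \<noteq> 0"
    and r: "r = [:poly p 0 + poly q 0, poly_trace p, 1:]"
  shows "char_2_pair p q r (coeff p 0) (coeff q 0) (coeff p 1)"
proof -
  define a b l k where "a = coeff p 0" "b = coeff q 0" "l = coeff p 1" "k = coeff q 1"
  note defs = this
  have p: "p = [:a, l, 1:]" and q: "q = [:b, k, 1:]" unfolding defs
    using monic_degree_2_eq assms by blast+
  have two: "(2 :: 'a) = 0"
    using same_discr_distinct_splitting_char_2[of a l b k] assms p q by simp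
  have four: "(4 :: 'a) = 0" using two by (metis mult_2 mult_zero_left numeral_Bit0 add.right_neutral)
  have neg: "- x = x" for x :: 'a using two by (metis add.inverse_unique mult_2 mult_zero_left)
  have "to_ac (l\<^sup>2) = to_ac (k\<^sup>2)" using assms(8) four by (simp add: p q discr_quadratic)
  then have "l\<^sup>2 = k\<^sup>2" by (simp only: to_ac_eq_iff)
  then have k: "k = l" using neg by (auto simp: power2_eq_iff)
  have l: "l \<noteq> 0" using assms(9) four by (auto simp: p discr_quadratic)
  have r: "r = [:a + b, l, 1:]" unfolding r poly_trace_def using neg by (simp add: p q)
  have "poly r c \<noteq> 0" for c
  proof
    assume c: "poly r c = 0"
    have two': "(2 :: 'a alg_closure) = 0" using two by (metis to_ac_0 to_ac_numeral)
    have c': "to_ac c * to_ac c + to_ac l * to_ac c + to_ac a + to_ac b = 0"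
      using arg_cong[OF c, of to_ac] by (simp add: r to_ac_add to_ac_mult algebra_simps)
    \<comment> \<open>Only the sum \<open>a' + b'\<close> is prescribed, so the same statement
      translates the roots of \<open>p\<close> to those of \<open>q\<close> and back.\<close>
    have shift: "x + to_ac c \<in> Root [:b', l, 1:]" if "x \<in> Root [:a', l, 1:]" "a' + b' = a + b" for x a' b'
    proof -
      have "to_ac a' + to_ac b' = to_ac a + to_ac b" using that(2) by (metis to_ac_add)
      moreover have "x * x + to_ac l * x + to_ac a' = 0" using that(1) by (simp add: Root_quadratic power2_eq_square)
      moreover have "(x + to_ac c) * (x + to_ac c) + to_ac l * (x + to_ac c) + to_ac b' =
        (x * x + to_ac l * x + to_ac a') + (to_ac c * to_ac c + to_ac l * to_ac c + (to_ac a' + to_ac b'))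
          + 2 * (x * to_ac c - to_ac a')"
        by (simp add: algebra_simps)
      ultimately show ?thesis using c' two' by (simp add: Root_quadratic power2_eq_square add.assoc)
    qed
    have sub: "splitting_field [:b', l, 1:] \<subseteq> splitting_field [:a', l, 1:]" if "a' + b' = a + b" for a' b'
    proof (rule splitting_field_subset)
      fix y assume "y \<in> Root [:b', l, 1:]"
      then have "y + to_ac c \<in> Root [:a', l, 1:]" using shift[of y b' a'] that by (simp add: add.commute)
      moreover have "y = to_ac c + to_ac 1 * (y + to_ac c)"
      proof -
        have "to_ac c + to_ac c = 0" using two' by (metis mult_2 mult_zero_left)
        then show ?thesis by (simp add: add.left_commute[of "to_ac c" y])
      qed
      ultimately show "\<exists>x\<in>Root [:a', l, 1:]. \<exists>c d. y = to_ac c + to_ac d * x" by blast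
    qed
    have "splitting_field p = splitting_field q"
      unfolding p q k using sub[of a b] sub[of b a] by (auto simp: add.commute)
    then show False using assms(7) by simp
  qed
  then have "irreducible r" by (intro irreducible_degree_2I) (simp add: r)
  then show ?thesis
    using two l p q r assms k unfolding defs[symmetric] by unfold_locales auto
qed

context char_2_pair
begin

lemma minus_eq: "- x = (x :: 'a)"
  using two by (metis add.inverse_unique mult_2 mult_zero_left)

lemma add_self: "x + x = (0 :: 'a)"
  using minus_eq[of x] by (simp add: eq_neg_iff_add_eq_0[symmetric])

lemma degree_r: "degree r = 2" and monic_r: "monic r"
  by (simp_all add: r)

lemma Root_r: "Root r = {x - y |x y. x \<in> Root p \<and> y \<in> Root q}"
proof -
  have two': "(2 :: 'a alg_closure) = 0" using two by (metis to_ac_0 to_ac_numeral)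
  \<comment> \<open>For \<open>y = x - z\<close> the difference \<open>r(z) - q(y)\<close> is
    \<open>- p(x)\<close> up to a multiple of 2. So, once a root \<open>x\<close> of
    \<open>p\<close> is fixed, \<open>z\<close> is a root of \<open>r\<close> exactly when
    \<open>x - z\<close> is a root of \<open>q\<close>.\<close>
  have key: "z * z + to_ac l * z + to_ac (a + b) = 0 \<longleftrightarrow> y * y + to_ac l * y + to_ac b = 0"
    if "x * x + to_ac l * x + to_ac a = 0" "y = x - z" for x y z
  proof -
    have "(z * z + to_ac l * z + to_ac (a + b)) - (y * y + to_ac l * y + to_ac b) =
        - (x * x + to_ac l * x + to_ac a) + 2 * (x * z + to_ac l * z + to_ac a)"
      by (simp add: that(2) algebra_simps)
    also have "\<dots> = 0" by (simp only: that(1) two' mult_zero_left minus_zero add_0)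
    finally have "z * z + to_ac l * z + to_ac (a + b) = y * y + to_ac l * y + to_ac b"
      by (simp only: right_minus_eq)
    then show ?thesis by (simp only:)
  qed
  show ?thesis
  proof (intro equalityI subsetI)
    fix z assume z: "z \<in> Root r"
    obtain x where x: "x \<in> Root p" using Root_nonempty p by blast
    then have "x - z \<in> Root q"
      using z key[of x "x - z" z] by (simp add: p q r Root_quadratic power2_eq_square)
    moreover have "z = x - (x - z)" by simp
    ultimately show "z \<in> {x - y |x y. x \<in> Root p \<and> y \<in> Root q}" using x by blast
  next
    fix z assume "z \<in> {x - y |x y. x \<in> Root p \<and> y \<in> Root q}"
    then obtain x y where "z = x - y" "x \<in> Root p" "y \<in> Root q" by blast
    then show "z \<in> Root r"
      using key[of x y z] by (simp add: p q r Root_quadratic power2_eq_square)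
  qed
qed

text \<open>The form is the norm of \<open>f + g x\<close>, with \<open>x\<close> a root of \<open>p\<close>. It is anisotropic over
  \<open>F[t]/(r)\<close> because an element \<open>c + d t\<close> of that field is a root of \<open>p\<close> only if \<open>d = 0\<close> and
  \<open>c\<close> is a root of \<open>p\<close>, or \<open>d = 1\<close> and \<open>c\<close> is a root of \<open>q\<close>.\<close>

lemma norm_form_anisotropic:
  assumes dvd: "r dvd f\<^sup>2 + smult l (f * g) + smult a (g\<^sup>2)"
  shows "r dvd f" "r dvd g"
proof -
  have r0: "r \<noteq> 0" using irr by auto
  show g: "r dvd g"
  proof (rule ccontr)
    assume "\<not> r dvd g"
    then obtain h s where hs: "h * g + s * r = 1" using irreducible_poly_bezout[OF irr(3)] by blast
    \<comment> \<open>\<open>h\<close> inverts \<open>g\<close> modulo \<open>r\<close>, so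
      \<open>k\<close> represents the quotient \<open>f / g\<close>; multiplying the form by
      \<open>h^2\<close> turns it into \<open>p(k)\<close> modulo \<open>r\<close>.\<close>
    define k where "k = (f * h) mod r"
    have cong: "r dvd f * h - k" "r dvd h * g - 1"
      using hs by (auto simp: k_def algebra_simps dvd_minus_mod intro: dvdI[of _ _ "- s"])
    have "degree k < 2" using degree_mod_less[OF r0, of "f * h"] degree_r by (auto simp: k_def)
    then obtain c d where k: "k = [:c, d:]" using degree_le_1_eq[of k] by auto
    have "k\<^sup>2 + smult l k + [:a:] = h\<^sup>2 * (f\<^sup>2 + smult l (f * g) + smult a (g\<^sup>2))
        - (f * h - k) * (f * h + k) - smult l (f * h - k) - smult l (f * h * (h * g - 1))
        - smult a ((h * g - 1) * (h * g + 1))"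
      by (simp add: algebra_simps power2_eq_square smult_add_right smult_diff_right one_pCons)
    moreover have "r dvd \<dots>"
      by (rule dvd_diff[OF dvd_diff[OF dvd_diff[OF dvd_diff[OF
        dvd_mult[OF dvd] dvd_mult2[OF cong(1)]] dvd_smult[OF cong(1)]]
        dvd_smult[OF dvd_mult[OF cong(2)]]] dvd_smult[OF dvd_mult2[OF cong(2)]]])
    ultimately have "r dvd k\<^sup>2 + smult l k + [:a:]" by simp
    \<comment> \<open>Subtracting \<open>d * d\<close> times \<open>r\<close> removes the term in
      \<open>t^2\<close>; what is left has degree at most 1, so being divisible by \<open>r\<close>
      makes it zero.\<close>
    then have "r dvd k\<^sup>2 + smult l k + [:a:] - smult (d * d) r" by (intro dvd_diff dvd_smult) auto
    also have "k\<^sup>2 + smult l k + [:a:] - smult (d * d) r =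
        [:c * c + l * c + a - d * d * (a + b), l * d - d * d * l:]"
      using add_self[of "c * d"] by (simp add: k r power2_eq_square algebra_simps)
    finally have "[:c * c + l * c + a - d * d * (a + b), l * d - d * d * l:] = 0"
      using dvd_imp_degree_le[of r] degree_r by (force split: if_splits)
    then have 1: "c * c + l * c + a - d * d * (a + b) = 0" and "l * d - d * d * l = 0" by auto
    then have "l * (d * (1 - d)) = 0" by (simp add: algebra_simps)
    then consider "d = 0" | "d = 1" using l by auto
    then show False
    proof cases
      case 1
      then have "poly p c = 0" using \<open>c * c + l * c + a - d * d * (a + b) = 0\<close> by (simp add: p algebra_simps)
      then show False using irreducible_degree_2_no_root[OF irr(1)] by (simp add: p)
    next
      case 2
      then have "c * c + l * c - b = 0" using 1 by (simp add: algebra_simps)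
      then have "poly q c = 0" using minus_eq[of b] by (simp add: q algebra_simps)
      then show False using irreducible_degree_2_no_root[OF irr(2)] by (simp add: q)
    qed
  qed
  have "r dvd smult l (f * g) + smult a (g\<^sup>2)" using g by (auto simp: power2_eq_square intro!: dvd_add dvd_smult)
  then have "r dvd f\<^sup>2" using dvd by (metis add.assoc dvd_add_left_iff)
  then show "r dvd f"
    using field_poly_irreducible_imp_prime[OF irr(3)] by (simp add: prime_elem_dvd_power)
qed

lemma pderiv_r: "pderiv r = [:l:]"
  using two by (simp add: r pderiv_pCons one_pCons numeral_2_eq_2)

text \<open>The coefficients acquire the factor \<open>(n + 1) * (n + 2)\<close>, a product of
  consecutive integers and hence even.\<close>

lemma pderiv_pderiv: "pderiv (pderiv f) = (0 :: 'a poly)"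
proof (rule poly_eqI)
  fix n
  have "even (Suc n * Suc (Suc n))" by simp
  then obtain t where "Suc n * Suc (Suc n) = 2 * t" by (elim evenE)
  then have "of_nat (Suc n) * of_nat (Suc (Suc n)) = (0 :: 'a)"
    using two by (metis mult_zero_left of_nat_mult of_nat_numeral)
  then show "coeff (pderiv (pderiv f)) n = coeff 0 n"
    by (simp add: coeff_pderiv mult.assoc[symmetric])
qed

end

section \<open>Differences\<close>

context endo_space
begin

lemma vec_add_self:
  assumes "(2 :: 'a) = 0"
  shows "v + v = (0 :: 'b)"
proof -
  have "v + v = (1 + 1 :: 'a) *s v" by (simp only: scale_left_distrib scale_one)
  then show ?thesis using assms by simp
qed

lemma act_quadratic: "act [:c, d, 1:] v = c *s v + d *s u v + u (u v)"
  by (simp add: u.add u.scale algebra_simps)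

end

section \<open>From a difference to socle dimensions\<close>

locale char_2_pair_endo = fin_dim_endo scale u Basis + char_2_pair p q r a b l
  for scale :: "'a::field \<Rightarrow> 'b::ab_group_add \<Rightarrow> 'b" (infixr "*s" 75)
    and u :: "'b \<Rightarrow> 'b" and Basis :: "'b set" and p q r :: "'a poly" and a b l :: 'a
begin

lemma vadd_self: "v + v = (0 :: 'b)"
  using two by (rule vec_add_self)

lemma vadd_self_left: "v + (v + w) = (w :: 'b)"
  by (simp add: vadd_self flip: add.assoc)

lemma vminus: "- v = (v :: 'b)"
  using vadd_self[of v] by (simp add: add_eq_0_iff)

lemma vdiff: "v - w = v + (w :: 'b)"
  using vminus[of w] by (metis diff_conv_add_uminus)

lemma sum_eq_0_iff: "v + w = 0 \<longleftrightarrow> v = (w :: 'b)"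
  by (metis add_eq_0_iff vminus)

lemmas vec2 = vadd_self vadd_self_left vminus vdiff

lemma act_r: "act r v = (a + b) *s v + l *s u v + u (u v)"
  by (simp only: r act_quadratic)

text \<open>The quartic field is not constructed. Instead a maximal independent set \<open>B\<close>
  whose span is stable under \<open>u\<close> and \<open>A\<close>, and whose size is a multiple of
  4, is shown to span \<open>W\<close>: a vector \<open>v\<close> outside its span would allow
  \<open>v\<close>, \<open>u v\<close>, \<open>A v\<close> and \<open>A (u v)\<close> to be
  added.\<close>

lemma dim_dvd_4:
  assumes A: "Vector_Spaces.linear scale scale A" and W: "subspace W"
    and uX: "\<And>v. v \<in> W \<Longrightarrow> u v \<in> W" and AX: "\<And>v. v \<in> W \<Longrightarrow> A v \<in> W"
    and rX: "\<And>v. v \<in> W \<Longrightarrow> act r v = 0"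
    and A2: "\<And>v. v \<in> W \<Longrightarrow> A (A v) = l *s A v + a *s v"
    and comm: "\<And>v. v \<in> W \<Longrightarrow> A (u v) = u (A v)"
  shows "4 dvd dim W"
proof -
  interpret A: Vector_Spaces.linear scale scale A by (rule A)
  have act_X: "act f v \<in> W" if "v \<in> W" for f v
    using invariant_act[of W] W uX that by (simp add: invariant_def)
  have comm_act: "A (act f v) = act f (A v)" if "v \<in> W" for f v
  proof (induction f)
    case (pCons c f)
    then show ?case using comm[OF act_X[OF that], of f] by (simp add: A.add A.scale)
  qed simp
  define good where "good B \<longleftrightarrow> B \<subseteq> W \<and> independent B \<and> 4 dvd card B \<and>
    (\<forall>x\<in>B. u x \<in> span B \<and> A x \<in> span B)" for B
  have "good {}" by (simp add: good_def independent_empty)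
  then have ex: "\<exists>k. \<exists>B. good B \<and> card B = k" by blast
  have bound: "\<exists>B. good B \<and> card B = k \<Longrightarrow> k \<le> dim (UNIV :: 'b set)" for k
    using independent_card_le_dim[of _ UNIV] by (auto simp: good_def)
  let ?Q = "\<lambda>k. \<exists>B. good B \<and> card B = k"
  have "?Q (GREATEST k. ?Q k)" by (rule GreatestI_ex_nat[of ?Q, OF ex bound])
  then obtain B where B: "good B" and cB: "card B = (GREATEST k. ?Q k)" by blast
  have max: "card B' \<le> card B" if "good B'" for B'
  proof -
    have "?Q (card B')" using that by blast
    then show ?thesis unfolding cB using bound by (rule Greatest_le_nat[of ?Q])
  qed
  have BX: "span B \<subseteq> W" using B W by (simp add: good_def span_minimal)
  have inv: "g x \<in> span C" if "Vector_Spaces.linear scale scale g" "\<forall>x\<in>C. g x \<in> span C" "x \<in> span C" for g x C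
  proof -
    interpret g: Vector_Spaces.linear scale scale g by (rule that(1))
    have "g ` span C = span (g ` C)" by (rule g.span_image[symmetric])
    also have "\<dots> \<subseteq> span C" using that(2) by (intro span_minimal) auto
    finally show ?thesis using that(3) by blast
  qed
  have uB: "u x \<in> span B" if "x \<in> span B" for x
    using inv[OF u.linear_axioms _ that] B by (simp add: good_def)
  have AB: "A x \<in> span B" if "x \<in> span B" for x
    using inv[OF A _ that] B by (simp add: good_def)
  have actB: "act f x \<in> span B" if "x \<in> span B" for f x
    using invariant_act[of "span B"] uB that by (simp add: invariant_def)
  have "W \<subseteq> span B"
  proof (rule ccontr)
    assume "\<not> W \<subseteq> span B"
    then obtain v where v: "v \<in> W" "v \<notin> span B" by blast
    have key: "r dvd f \<and> r dvd g" if "act f v + A (act g v) \<in> span B" for f g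
    proof -
      define n where "n = f\<^sup>2 + smult l (f * g) + smult a (g\<^sup>2)"
      define x y where "x = act f v" and "y = act g v"
      have xy: "x \<in> W" "y \<in> W" "A y \<in> W" using v act_X AX by (auto simp: x_def y_def)
      let ?z = "x + A y"
      have z: "?z \<in> span B" using that by (simp add: x_def y_def)
      \<comment> \<open>The operator applied to \<open>?z\<close> is the conjugate of
        \<open>f + g A\<close>, with \<open>A\<close> replaced by \<open>A + l\<close>, the other
        root of \<open>p\<close>. The product of the two is the norm \<open>n\<close>, which no
        longer involves \<open>A\<close>.\<close>
      have "act f ?z + A (act g ?z) + l *s act g ?z \<in> span B"
        using z actB AB by (intro span_add span_scale) auto
      also have "act f ?z + A (act g ?z) + l *s act g ?z =
          act f x + A (act f y) + (A (act g x) + (l *s A (act g y) + a *s act g y))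
            + (l *s act g x + l *s A (act g y))"
        using xy act_X A2[of "act g y"]
        by (simp add: act_vec_add A.add scale_right_distrib comm_act[symmetric])
      also have "act f y = act g x" by (simp add: x_def y_def act_commute)
      also have "act f x + A (act g x) + (A (act g x) + (l *s A (act g y) + a *s act g y))
            + (l *s act g x + l *s A (act g y)) = act f x + l *s act g x + a *s act g y"
        by (simp add: vec2 ac_simps)
      also have "\<dots> = act n v"
        by (simp add: n_def x_def y_def act_add act_smult power2_eq_square act_mult act_commute[of f g])
      finally have n: "act n v \<in> span B" .
      \<comment> \<open>Otherwise \<open>n\<close> is invertible modulo \<open>r\<close>, and
        \<open>v\<close> would be recovered from \<open>act n v\<close> inside the span of
        \<open>B\<close>.\<close>
      have "r dvd n"
      proof (rule ccontr)
        assume "\<not> r dvd n"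
        then obtain s t where st: "s * n + t * r = 1" using irreducible_poly_bezout[OF irr(3)] by blast
        have "v = act (s * n + t * r) v" by (simp add: st)
        also have "\<dots> = act s (act n v)" using rX[OF v(1)] by (simp add: act_add act_mult)
        finally show False using actB[OF n, of s] v(2) by simp
      qed
      then show ?thesis using norm_form_anisotropic[of f g] by (simp add: n_def)
    qed
    \<comment> \<open>Each dependence among the four new vectors modulo the span of \<open>B\<close>
      has the form treated in \<open>key\<close> with \<open>f\<close> and \<open>g\<close> of
      degree at most 1, at least one of them nonzero.\<close>
    have nd: "\<not> r dvd [:c, d:]" if "[:c, d:] \<noteq> 0" for c d
      using dvd_imp_degree_le[of r "[:c, d:]"] degree_r that by (auto split: if_splits)
    let ?B1 = "insert v B" let ?B2 = "insert (u v) ?B1"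
    let ?B3 = "insert (A v) ?B2" let ?B4 = "insert (A (u v)) ?B3"
    have n1: "v \<notin> span B" by (rule v(2))
    have n2: "u v \<notin> span ?B1"
    proof
      assume "u v \<in> span ?B1"
      then obtain c where "u v - c *s v \<in> span B" by (auto simp: span_breakdown_eq)
      then have "act [:- c, 1:] v + A (act 0 v) \<in> span B" by (simp add: u.zero A.zero)
      then show False using key[of "[:- c, 1:]" 0] nd[of "- c" 1] by simp
    qed
    have n3: "A v \<notin> span ?B2"
    proof
      assume "A v \<in> span ?B2"
      then obtain c d where "A v - d *s u v - c *s v \<in> span B" by (auto simp: span_breakdown_eq)
      then have "act [:- c, - d:] v + A (act 1 v) \<in> span B"
        by (simp add: u.zero algebra_simps u.scale u.neg)
      then show False using key[of "[:- c, - d:]" 1] nd[of 1 0] by (simp add: one_pCons)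
    qed
    have n4: "A (u v) \<notin> span ?B3"
    proof
      assume "A (u v) \<in> span ?B3"
      then obtain c d e where "A (u v) - e *s A v - d *s u v - c *s v \<in> span B"
        by (auto simp: span_breakdown_eq)
      then have "act [:- c, - d:] v + A (act [:- e, 1:] v) \<in> span B"
        by (simp add: u.zero A.zero algebra_simps u.scale u.neg A.add A.scale A.neg A.diff)
      then show False using key[of "[:- c, - d:]" "[:- e, 1:]"] nd[of "- e" 1] by simp
    qed
    have fin: "finite B" using B by (auto simp: good_def intro: finiteI_independent)
    have ind: "independent ?B4"
      using B n1 n2 n3 n4 by (simp add: good_def independent_insert)
    have notin: "v \<notin> B" "u v \<notin> ?B1" "A v \<notin> ?B2" "A (u v) \<notin> ?B3"
      using n1 n2 n3 n4 by (metis span_base)+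
    have card: "card ?B4 = card B + 4" using notin fin by simp
    have base: "v \<in> span ?B4" "u v \<in> span ?B4" "A v \<in> span ?B4" "A (u v) \<in> span ?B4"
      by (auto intro: span_base)
    have sub: "x \<in> span B \<Longrightarrow> x \<in> span ?B4" for x
      using span_mono[of B ?B4] by blast
    have uu: "u (u v) = (a + b) *s v + l *s u v"
      using rX[OF v(1)] by (simp add: act_r sum_eq_0_iff)
    have uuA: "u (A (u v)) = (a + b) *s A v + l *s A (u v)"
      using comm[OF uX[OF v(1)]] by (simp add: uu A.add A.scale)
    have AA: "A (A v) = l *s A v + a *s v" "A (A (u v)) = l *s A (u v) + a *s u v"
      using A2 v(1) uX by auto
    have closed: "u x \<in> span ?B4 \<and> A x \<in> span ?B4" if "x \<in> ?B4" for x
    proof -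
      consider "x \<in> B" | "x = v" | "x = u v" | "x = A v" | "x = A (u v)" using \<open>x \<in> ?B4\<close> by blast
      then show ?thesis
      proof cases
        case 1
        then show ?thesis using B sub by (simp add: good_def)
      qed (simp_all add: uu uuA AA base comm[OF v(1), symmetric] span_add span_scale)
    qed
    have "good ?B4"
      unfolding good_def
    proof (intro conjI)
      show "?B4 \<subseteq> W" using B v uX AX by (simp add: good_def)
      show "4 dvd card ?B4" unfolding card using B by (simp add: good_def)
    qed (use ind closed in auto)
    then have "card ?B4 \<le> card B" by (rule max)
    then show False using card by simp
  qed
  then have "span B = W" using BX by blast
  then have "dim W = card B"
    using dim_eq_card_independent[of B] dim_span[of B] B by (simp add: good_def)
  then show ?thesis using B by (simp add: good_def)
qed

lemma pq_difference_socle_dim: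
  assumes "pq_difference scale p q u"
  shows "4 dvd socle_dim r j"
proof -
  obtain A B where lin: "endo scale A" "endo scale B" and ann: "annihilates scale p A" "annihilates scale q B"
    and u_eq: "u = (\<lambda>v. A v - B v)"
    using assms by (auto simp: pq_difference_def)
  interpret A: endo_space scale A by unfold_locales (rule lin)
  interpret B: endo_space scale B by unfold_locales (rule lin)
  have A2: "A (A v) = l *s A v + a *s v" for v
    using ann(1) A.act_quadratic[of a l v] sum_eq_0_iff[of "a *s v + l *s A v" "A (A v)"]
    by (simp add: annihilates_def p add.commute)
  have B2: "B (B v) = l *s B v + b *s v" for v
    using ann(2) B.act_quadratic[of b l v] sum_eq_0_iff[of "b *s v + l *s B v" "B (B v)"]
    by (simp add: annihilates_def q add.commute)
  have B: "B v = A v + u v" for v by (simp add: u_eq vec2)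
  \<comment> \<open>In characteristic 2, \<open>q(A + u) = p(A) + (A u + u A) + r(u)\<close>, and
    both \<open>q(A + u)\<close> and \<open>p(A)\<close> vanish.\<close>
  have Auu: "A (u v) = u (A v) + act r v" for v
  proof -
    have "A (A v) + A (u v) + u (A v) + u (u v) = B (B v)"
      by (simp add: B A.u.add u.add ac_simps)
    also have "\<dots> = l *s A v + l *s u v + b *s v" by (simp add: B2) (simp add: B scale_right_distrib)
    finally have "A (u v) + (u (A v) + (l *s A v + a *s v + u (u v))) = l *s A v + l *s u v + b *s v"
      by (simp add: A2 ac_simps)
    then have "A (u v) = l *s A v + l *s u v + b *s v + (u (A v) + (l *s A v + a *s v + u (u v)))"
      by (metis add_diff_cancel_right' vdiff)
    then show ?thesis by (simp add: act_r scale_left_distrib vec2 ac_simps)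
  qed
  have Ar: "A (act r v) = act r (A v) + l *s act r v" for v
  proof -
    \<comment> \<open>With \<open>r(u)\<close> written as \<open>A u + u A\<close>, the term
      \<open>A u A\<close> cancels in \<open>A r(u) + r(u) A\<close>, and
      \<open>A^2 = l A + a\<close> reduces the rest to \<open>l r(u)\<close>.\<close>
    have r_eq: "act r w = A (u w) + u (A w)" for w by (simp add: Auu vec2 ac_simps)
    have "A (act r v) = l *s A (u v) + a *s u v + A (u (A v))"
      by (simp add: r_eq A.u.add A2)
    moreover have "act r (A v) = A (u (A v)) + l *s u (A v) + a *s u v"
      by (simp add: r_eq A2 u.add u.scale ac_simps)
    ultimately show ?thesis by (simp add: r_eq scale_right_distrib vec2 ac_simps)
  qed
  have range: "\<exists>w. A (act (r ^ j) v) = act (r ^ j) w" for v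
  proof (induction j arbitrary: v)
    case (Suc j)
    obtain w where w: "A (act (r ^ j) v) = act (r ^ j) w" using Suc.IH by blast
    have "A (act (r ^ Suc j) v) = act (r ^ Suc j) (w + l *s v)"
      by (simp add: act_mult Ar w act_vec_add act_vec_scale)
    then show ?case by blast
  qed simp
  show ?thesis
    unfolding socle_dim_def
  proof (rule dim_dvd_4[where A = A])
    have inv: "invariant {v \<in> range (act (r ^ j)). act r v = 0}"
      by (intro invariant_kernel invariant_image invariant_UNIV)
    show "subspace {v \<in> range (act (r ^ j)). act r v = 0}" using inv by (rule invariant_subspace)
    fix v assume v: "v \<in> {v \<in> range (act (r ^ j)). act r v = 0}"
    show "u v \<in> {v \<in> range (act (r ^ j)). act r v = 0}" using inv v by (simp add: invariant_def)
    have "act r (A v) = 0" using Ar[of v] v by (simp add: A.u.zero)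
    then show "A v \<in> {v \<in> range (act (r ^ j)). act r v = 0}" using v range by auto
    show "A (u v) = u (A v)" using v by (simp add: Auu)
  qed (use A.u.linear_axioms A2 in auto)
qed

text \<open>On \<open>F[t]/(r\<^sup>n)\<close> the derivation \<open>\<delta> f = r f'\<close> satisfies \<open>[\<delta>, t] = r\<close> and, in
  characteristic 2, \<open>\<delta>\<^sup>2 = l \<delta>\<close>. On the sum of two copies, \<open>A\<close> is \<open>\<delta>\<close> plus the
  companion matrix of \<open>p\<close>.\<close>

definition twist :: "(nat \<Rightarrow> 'a poly) \<Rightarrow> nat \<Rightarrow> 'a poly" where
  "twist f i = r * pderiv (f i) +
     (if even i then smult a (f (i + 1)) else f (i - 1) + smult l (f i))"

lemma padd_self: "f + f = (0 :: 'a poly)"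
  by (rule poly_eqI) (simp only: coeff_add add_self coeff_0)

lemma padd_self_left: "f + (f + g) = (g :: 'a poly)"
  by (simp add: padd_self flip: add.assoc)

lemma twist_add: "twist (\<lambda>i. f i + g i) = (\<lambda>i. twist f i + twist g i)"
  by (rule ext) (simp add: twist_def pderiv_add smult_add_right algebra_simps)

lemma twist_smult: "twist (\<lambda>i. smult c (f i)) = (\<lambda>i. smult c (twist f i))"
  by (rule ext) (simp add: twist_def pderiv_smult smult_add_right mult.commute)

lemma twist_diff: "twist (\<lambda>i. f i - g i) = (\<lambda>i. twist f i - twist g i)"
  using twist_add[of "\<lambda>i. f i - g i" g] by (simp add: fun_eq_iff)

lemma twist_shift: "twist (\<lambda>i. pCons 0 (f i)) = (\<lambda>i. pCons 0 (twist f i) + r * f i)"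
  by (rule ext) (simp add: twist_def pderiv_pCons algebra_simps)

text \<open>The derivation and the matrix commute because the matrix entries are constants, so their
  cross terms occur twice and cancel. The square of each part is computed separately:
  \<open>pderiv_r\<close> and \<open>pderiv_pderiv\<close> handle the derivation, and the matrix is
  a root of \<open>p\<close>.\<close>

lemma twist_twist: "twist (twist f) = (\<lambda>i. smult l (twist f i) + smult a (f i))"
proof
  fix i
  have pd: "pderiv (r * pderiv g) = smult l (pderiv g)" for g
    by (simp add: pderiv_mult pderiv_r pderiv_pderiv)
  show "twist (twist f) i = smult l (twist f i) + smult a (f i)"
    by (cases "even i")
      (simp add: twist_def[of "twist f"], simp add: twist_def pd pderiv_add pderiv_smult
        smult_add_right algebra_simps padd_self padd_self_left)+
qed

text \<open>Differentiation costs one power of \<open>s\<close>, which the factor \<open>s\<close>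
  restores. Hence the derivation preserves the ideal of \<open>r ^ n\<close> and acts on the
  quotient.\<close>

lemma power_dvd_mult_pderiv:
  fixes s :: "'a poly"
  assumes "s ^ n dvd f"
  shows "s ^ n dvd s * pderiv f"
proof (cases n)
  case (Suc k)
  from assms obtain g where "f = s ^ n * g" by (elim dvdE)
  then have "pderiv f = s ^ n * pderiv g + smult (of_nat n) (s ^ k) * pderiv s * g"
    by (simp add: Suc pderiv_mult pderiv_power_Suc mult.commute del: power_Suc of_nat_Suc)
  then have "s * pderiv f = s ^ n * (s * pderiv g + smult (of_nat n) (pderiv s * g))"
    by (simp add: Suc algebra_simps del: of_nat_Suc)
  then show ?thesis by simp
qed simp

lemma paired_decomp_imp_pq_difference:
  assumes dec: "cyclic_decomp UNIV (2 * m) (\<lambda>i. r ^ \<nu> (i div 2)) vs"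
  shows "pq_difference scale p q u"
proof -
  let ?comb = "comb (2 * m) vs"
  have surj: "\<exists>f. v = ?comb f" for v
    using dec by (auto simp: cyclic_decomp_def)
  \<comment> \<open>The coefficients of \<open>v\<close> are chosen arbitrarily; the next claim
    shows that the choice does not matter. It needs both members of a pair to have the same modulus,
    because \<open>twist\<close> mixes them.\<close>
  define A where "A v = ?comb (twist (SOME f. v = ?comb f))" for v
  have A: "A (?comb f) = ?comb (twist f)" for f
  proof -
    define g where "g = (SOME g. ?comb f = ?comb g)"
    have g: "?comb f = ?comb g" unfolding g_def by (rule someI[of _ f]) simp
    define h where "h = (\<lambda>i. g i - f i)"
    have "?comb h = 0" using g by (simp add: h_def flip: comb_diff)
    then have h: "r ^ \<nu> (i div 2) dvd h i" if "i < 2 * m" for i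
      using that comb_eq_0_iff[OF dec] by simp
    have "r ^ \<nu> (i div 2) dvd twist h i" if i: "i < 2 * m" for i
    proof (cases "even i")
      case True
      then have "i + 1 < 2 * m" "(i + 1) div 2 = i div 2" using i by presburger+
      then have "r ^ \<nu> (i div 2) dvd h (i + 1)" using h[of "i + 1"] by simp
      then show ?thesis using True power_dvd_mult_pderiv[OF h[OF i]] by (simp add: twist_def dvd_smult)
    next
      case False
      then have "i - 1 < 2 * m" "(i - 1) div 2 = i div 2" using i by presburger+
      then have "r ^ \<nu> (i div 2) dvd h (i - 1)" using h[of "i - 1"] by simp
      then show ?thesis
        using False power_dvd_mult_pderiv[OF h[OF i]] h[OF i] by (simp add: twist_def dvd_smult)
    qed
    then have "?comb (twist h) = 0" by (simp add: comb_eq_0_iff[OF dec])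
    moreover have "twist h = (\<lambda>i. twist g i - twist f i)" by (simp add: h_def twist_diff)
    ultimately have "?comb (twist g) = ?comb (twist f)" by (simp flip: comb_diff)
    then show ?thesis by (simp add: A_def g_def)
  qed
  have linA: "Vector_Spaces.linear scale scale A"
  proof unfold_locales
    fix x y
    obtain f g where "x = ?comb f" "y = ?comb g" using surj by metis
    then show "A (x + y) = A x + A y" by (simp add: A comb_add twist_add)
  next
    fix c x
    obtain f where "x = ?comb f" using surj by metis
    then show "A (c *s x) = c *s A x" by (simp add: A comb_scale twist_smult)
  qed
  interpret A: endo_space scale A by unfold_locales (simp add: endo_def linA)
  define B where "B v = A v - u v" for v
  have linB: "Vector_Spaces.linear scale scale B"
    by unfold_locales (simp_all add: B_def A.u.add A.u.scale u.add u.scale scale_right_diff_distrib)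
  interpret B: endo_space scale B by unfold_locales (simp add: endo_def linB)
  have A2: "A (A v) = l *s A v + a *s v" for v
  proof -
    obtain f where "v = ?comb f" using surj by metis
    then show ?thesis by (simp add: A comb_scale comb_add twist_twist)
  qed
  have Au: "A (u v) = u (A v) + act r v" for v
  proof -
    obtain f where "v = ?comb f" using surj by metis
    then show ?thesis by (simp add: A comb_u act_comb comb_add twist_shift)
  qed
  have "annihilates scale p A"
    unfolding annihilates_def p A.act_quadratic by (simp add: A2 vec2 ac_simps)
  \<comment> \<open>The identity \<open>q(A + u) = p(A) + (A u + u A) + r(u)\<close> again: now
    \<open>p(A) = 0\<close> and \<open>A u + u A = r(u)\<close> make the right-hand side
    vanish.\<close>
  moreover have "annihilates scale q B"
    unfolding annihilates_def q B.act_quadratic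
    by (simp add: B_def A.u.diff u.diff A2 Au act_r scale_right_distrib scale_left_distrib vec2 ac_simps
        A.u.add u.add)
  moreover have "u = (\<lambda>v. A v - B v)" by (simp add: B_def)
  ultimately show ?thesis
    using linA linB unfolding pq_difference_def endo_def by blast
qed

end

section \<open>Eigenvalues in the algebraic closure\<close>

interpretation to_ac_hom: map_poly_inj_idom_hom to_ac
  by unfold_locales (auto simp: to_ac_add to_ac_mult)

lemma (in endo_space) act_eigenvector: "u x = z *s x \<Longrightarrow> act f x = poly f z *s x"
  by (induction f) (auto simp: u.scale scale_left_distrib mult.commute)

text \<open>Linear factors are split off \<open>g\<close> until one of them kills a nonzero vector.
  The eigenvector is returned as a polynomial in \<open>u\<close> applied to \<open>x\<close>, so
  that it stays in every invariant subspace containing \<open>x\<close>.\<close>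

lemma exists_eigenvector_alg_closed:
  fixes scale :: "'k::alg_closed_field \<Rightarrow> 'v::ab_group_add \<Rightarrow> 'v"
  assumes "endo_space scale u" "g \<noteq> 0" "poly_endo scale g u x = 0" "x \<noteq> 0"
  shows "\<exists>z h. poly g z = 0 \<and> poly_endo scale h u x \<noteq> 0 \<and>
    u (poly_endo scale h u x) = scale z (poly_endo scale h u x)"
proof -
  interpret endo_space scale u by (rule assms(1))
  show ?thesis
    using assms(2,3)
  proof (induction "degree g" arbitrary: g rule: less_induct)
    case less
    show ?case
    proof (cases "degree g = 0")
      case True
      then obtain c where "g = [:c:]" using degree_eq_zeroE by blast
      then show ?thesis using less.prems assms(4) by (simp add: u.zero)
    next
      case False
      then obtain z where z: "poly g z = 0" using alg_closed_imp_poly_has_root[of g] by blast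
      then obtain h where g: "g = [:- z, 1:] * h" by (metis dvdE poly_eq_0_iff_dvd)
      show ?thesis
      proof (cases "act h x = 0")
        case True
        have h: "h \<noteq> 0" using g less.prems by auto
        then have "degree g = Suc (degree h)" unfolding g by (subst degree_mult_eq) auto
        then obtain y k where "poly h y = 0" "act k x \<noteq> 0" "u (act k x) = scale y (act k x)"
          using less.hyps[of h] h True by auto
        then show ?thesis unfolding g by auto
      next
        case False
        have "act [:- z, 1:] (act h x) = 0" using less.prems by (simp only: g act_mult)
        then have "u (act h x) = scale z (act h x)" by (simp add: u.zero)
        then show ?thesis using z False by blast
      qed
    qed
  qed
qed

text \<open>Vectors over the algebraic closure are modelled by polynomials; a matrix of size \<open>n\<close> acts
  on the coefficients up to degree \<open>n - 1\<close>.\<close>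

definition mat_on_poly :: "nat \<Rightarrow> 'k::field mat \<Rightarrow> 'k poly \<Rightarrow> 'k poly" where
  "mat_on_poly n M f = (\<Sum>i<n. monom (\<Sum>j<n. M $$ (i, j) * coeff f j) i)"

lemma coeff_mat_on_poly:
  "coeff (mat_on_poly n M f) i = (if i < n then \<Sum>j<n. M $$ (i, j) * coeff f j else 0)"
  by (simp add: mat_on_poly_def coeff_sum)

lemma vector_space_smult: "vector_space (smult :: 'k::field \<Rightarrow> _)"
  by unfold_locales (auto simp: smult_add_right smult_add_left)

lemma endo_space_mat_on_poly: "endo_space smult (mat_on_poly n M)"
proof -
  interpret vector_space "smult :: 'a \<Rightarrow> _" by (rule vector_space_smult)
  show ?thesis
    by (intro endo_space.intro vector_space_smult endo_space_axioms.intro)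
      (unfold endo_def, unfold_locales,
       auto simp: poly_eq_iff coeff_mat_on_poly sum.distrib distrib_left sum_distrib_left mult.left_commute)
qed

text \<open>\<open>mat_on_poly\<close> sends the monomials of degree at least \<open>n\<close> to 0,
  which would add a spurious eigenvalue 0; eigenvectors are therefore sought only here.\<close>

definition poly_below :: "nat \<Rightarrow> 'k::field poly set" where
  "poly_below n = {f. \<forall>i\<ge>n. coeff f i = 0}"

lemma eigenvalue_mat_on_poly_iff:
  assumes M: "M \<in> carrier_mat n n"
  shows "eigenvalue M z \<longleftrightarrow> (\<exists>f\<in>poly_below n. f \<noteq> 0 \<and> mat_on_poly n M f = smult z f)"
proof
  assume "eigenvalue M z"
  then obtain v where v: "v \<in> carrier_vec n" "v \<noteq> 0\<^sub>v n" "M *\<^sub>v v = z \<cdot>\<^sub>v v"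
    using M by (auto simp: eigenvalue_def eigenvector_def)
  define f where "f = (\<Sum>i<n. monom (v $ i) i)"
  have cf: "coeff f i = (if i < n then v $ i else 0)" for i by (simp add: f_def coeff_sum)
  have "(\<Sum>j<n. M $$ (i, j) * coeff f j) = z * v $ i" if i: "i < n" for i
  proof -
    have "(M *\<^sub>v v) $ i = z * v $ i" using v i by simp
    moreover have "(M *\<^sub>v v) $ i = (\<Sum>j<n. M $$ (i, j) * v $ j)"
      using M v(1) i by (simp add: scalar_prod_def atLeast0LessThan)
    ultimately show ?thesis by (simp add: cf)
  qed
  then have "mat_on_poly n M f = smult z f" by (simp add: poly_eq_iff coeff_mat_on_poly cf)
  moreover have "f \<noteq> 0"
  proof
    assume "f = 0"
    then have "v $ i = 0" if "i < n" for i using cf[of i] that by simp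
    then have "v = 0\<^sub>v n" using v(1) by (intro eq_vecI) auto
    then show False using v(2) by simp
  qed
  ultimately show "\<exists>f\<in>poly_below n. f \<noteq> 0 \<and> mat_on_poly n M f = smult z f"
    by (intro bexI[of _ f]) (auto simp: poly_below_def cf)
next
  assume "\<exists>f\<in>poly_below n. f \<noteq> 0 \<and> mat_on_poly n M f = smult z f"
  then obtain f where f: "\<And>i. n \<le> i \<Longrightarrow> coeff f i = 0" "f \<noteq> 0" "mat_on_poly n M f = smult z f"
    by (auto simp: poly_below_def)
  define v where "v = vec n (coeff f)"
  have "(M *\<^sub>v v) $ i = (z \<cdot>\<^sub>v v) $ i" if i: "i < n" for i
  proof -
    have "(M *\<^sub>v v) $ i = (\<Sum>j<n. M $$ (i, j) * coeff f j)"
      using M i by (simp add: scalar_prod_def atLeast0LessThan v_def)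
    also have "\<dots> = coeff (mat_on_poly n M f) i" using i by (simp add: coeff_mat_on_poly)
    also have "\<dots> = (z \<cdot>\<^sub>v v) $ i" using i by (simp add: f(3) v_def)
    finally show ?thesis .
  qed
  then have "M *\<^sub>v v = z \<cdot>\<^sub>v v" using M by (intro eq_vecI) (auto simp: v_def)
  moreover have "v \<noteq> 0\<^sub>v n"
  proof
    assume "v = 0\<^sub>v n"
    then have "coeff f i = 0" if "i < n" for i
      using that by (metis index_vec index_zero_vec(1) v_def)
    then have "f = 0" using f(1) by (intro poly_eqI) (metis coeff_0 not_le)
    then show False using f(2) by simp
  qed
  ultimately show "eigenvalue M z"
    using M unfolding eigenvalue_def eigenvector_def by (intro exI[of _ v]) (auto simp: v_def)
qed

section \<open>Passage to matrices over the algebraic closure\<close>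

context fin_dim_endo
begin

definition coords :: "'b list \<Rightarrow> 'b \<Rightarrow> 'a alg_closure poly" where
  "coords bs v = (\<Sum>i<length bs. monom (to_ac (representation (set bs) v (bs ! i))) i)"

lemma coeff_coords:
  "coeff (coords bs v) i = (if i < length bs then to_ac (representation (set bs) v (bs ! i)) else 0)"
  by (simp add: coords_def coeff_sum)

lemma sum_set_nth: "distinct bs \<Longrightarrow> (\<Sum>b\<in>set bs. g b) = (\<Sum>i<length bs. g (bs ! i))"
  by (rule sum.reindex_bij_betw[OF bij_betw_nth, symmetric]) auto

context
  fixes bs M
  assumes rep: "represented_in scale bs u M"
begin

lemma basis: "distinct bs" "independent (set bs)" "span (set bs) = UNIV"
  using rep by (auto simp: represented_in_def ordered_basis_def)

lemma coords_add: "coords bs (v + w) = coords bs v + coords bs w"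
  using basis by (simp add: poly_eq_iff coeff_coords representation_add)

lemma coords_scale: "coords bs (c *s v) = smult (to_ac c) (coords bs v)"
  using basis by (simp add: poly_eq_iff coeff_coords representation_scale)

lemma coords_sum: "coords bs (\<Sum>i\<in>I. f i) = (\<Sum>i\<in>I. coords bs (f i))"
proof (induction I rule: infinite_finite_induct)
  case empty
  then show ?case using coords_scale[of 0 0] by simp
next
  case (infinite I)
  then show ?case using coords_scale[of 0 0] by simp
qed (simp add: coords_add)

lemma coords_basis: "j < length bs \<Longrightarrow> coords bs (bs ! j) = monom 1 j"
  using basis by (auto simp: poly_eq_iff coeff_coords representation_basis nth_eq_iff_index_eq)

lemma sum_coords: "v = (\<Sum>i<length bs. representation (set bs) v (bs ! i) *s bs ! i)"
proof -
  have "v = (\<Sum>b\<in>set bs. representation (set bs) v b *s b)"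
    using basis by (intro sum_representation_eq[symmetric]) auto
  then show ?thesis unfolding sum_set_nth[OF basis(1)] .
qed

lemma coords_eq_0: "coords bs v = 0 \<Longrightarrow> v = 0"
proof -
  assume "coords bs v = 0"
  then have "representation (set bs) v (bs ! i) = 0" if "i < length bs" for i
    using coeff_coords[of bs v i] that by simp
  then show "v = 0" by (subst sum_coords) simp
qed

lemma coords_u: "coords bs (u v) = mat_on_poly (length bs) (map_mat to_ac M) (coords bs v)"
proof -
  let ?n = "length bs" and ?c = "\<lambda>v i. representation (set bs) v (bs ! i)"
  have M: "M \<in> carrier_mat ?n ?n" and uM: "\<And>j. j < ?n \<Longrightarrow> u (bs ! j) = (\<Sum>i<?n. M $$ (i, j) *s bs ! i)"
    using rep by (auto simp: represented_in_def)
  have ub: "coords bs (u (bs ! j)) = (\<Sum>i<?n. monom (to_ac (M $$ (i, j))) i)" if "j < ?n" for j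
    unfolding uM[OF that] coords_sum coords_scale
    by (rule sum.cong) (simp_all add: coords_basis smult_monom)
  have "coords bs (u v) = coords bs (u (\<Sum>j<?n. ?c v j *s bs ! j))" using sum_coords by simp
  also have "\<dots> = (\<Sum>j<?n. smult (to_ac (?c v j)) (\<Sum>i<?n. monom (to_ac (M $$ (i, j))) i))"
    unfolding u.sum u.scale coords_sum coords_scale by (rule sum.cong) (simp_all add: ub)
  also have "\<dots> = mat_on_poly ?n (map_mat to_ac M) (coords bs v)"
    using M by (simp add: poly_eq_iff coeff_mat_on_poly coeff_sum coeff_coords mult.commute
        if_distrib[of "\<lambda>x. _ * x"] cong: if_cong)
  finally show ?thesis .
qed

lemma coords_act:
  "coords bs (act f v) = poly_endo smult (map_poly to_ac f) (mat_on_poly (length bs) (map_mat to_ac M)) (coords bs v)"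
proof -
  interpret L: endo_space smult "mat_on_poly (length bs) (map_mat to_ac M)"
    by (rule endo_space_mat_on_poly)
  show ?thesis
  proof (induction f)
    case 0
    then show ?case using coords_scale[of 0 0] by simp
  next
    case (pCons c f)
    then show ?case
      by (simp add: map_poly_pCons coords_add coords_scale coords_u)
  qed
qed

text \<open>The coordinates of the basis vectors span the extended space over the closure, so an
  annihilator of \<open>u\<close> also annihilates the extended matrix, in particular an eigenvector
  for \<open>z\<close>.\<close>

lemma eigenvalue_root_of_annihilator:
  assumes "annihilates scale f u" "eigenvalue (map_mat to_ac M) z"
  shows "poly (map_poly to_ac f) z = 0"
proof -
  let ?n = "length bs" and ?M = "map_mat to_ac M"
  interpret L: endo_space smult "mat_on_poly ?n ?M" by (rule endo_space_mat_on_poly)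
  have "?M \<in> carrier_mat ?n ?n" using rep by (auto simp: represented_in_def)
  then obtain g where g: "g \<in> poly_below ?n" "g \<noteq> 0" "mat_on_poly ?n ?M g = smult z g"
    using assms(2) by (auto simp: eigenvalue_mat_on_poly_iff)
  have "g = (\<Sum>j<?n. smult (coeff g j) (coords bs (bs ! j)))"
    using g(1) by (auto simp: poly_eq_iff coeff_sum coords_basis poly_below_def not_less
        if_distrib[of "\<lambda>x. _ * x"] cong: if_cong)
  then have "L.act (map_poly to_ac f) g =
      (\<Sum>j<?n. smult (coeff g j) (L.act (map_poly to_ac f) (coords bs (bs ! j))))"
    by (metis (no_types, lifting) L.act_vec_scale L.act_vec_sum sum.cong)
  also have "\<dots> = (\<Sum>j<?n. smult (coeff g j) (coords bs (act f (bs ! j))))"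
    by (simp only: coords_act)
  also have "\<dots> = 0" using assms(1) coords_scale[of 0 0] by (simp add: annihilates_def)
  finally have "smult (poly (map_poly to_ac f) z) g = 0" using L.act_eigenvector[OF g(3)] by simp
  then show ?thesis using g(2) by simp
qed

lemma root_eigenvalue:
  assumes "f \<noteq> 0" "act f v = 0" "v \<noteq> 0"
  shows "\<exists>z. poly (map_poly to_ac f) z = 0 \<and> eigenvalue (map_mat to_ac M) z"
proof -
  let ?n = "length bs" and ?M = "map_mat to_ac M"
  interpret L: endo_space smult "mat_on_poly ?n ?M" by (rule endo_space_mat_on_poly)
  have M: "?M \<in> carrier_mat ?n ?n" using rep by (auto simp: represented_in_def)
  have "L.act (map_poly to_ac f) (coords bs v) = 0"
    using coords_act[of f v] assms(2) coords_scale[of 0 0] by simp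
  moreover have "coords bs v \<noteq> 0" using coords_eq_0 assms(3) by blast
  moreover have "map_poly to_ac f \<noteq> 0" using assms(1) by (simp add: map_poly_eq_0_iff)
  ultimately obtain z h where zh: "poly (map_poly to_ac f) z = 0" "L.act h (coords bs v) \<noteq> 0"
    "mat_on_poly ?n ?M (L.act h (coords bs v)) = smult z (L.act h (coords bs v))"
    using exists_eigenvector_alg_closed[OF L.endo_space_axioms, of "map_poly to_ac f" "coords bs v"]
    by blast
  have "L.invariant (poly_below ?n)"
    unfolding L.invariant_def by (auto simp: poly_below_def coeff_mat_on_poly intro!: L.subspaceI)
  then have "L.act h (coords bs v) \<in> poly_below ?n"
    by (rule L.invariant_act) (simp add: poly_below_def coeff_coords)
  then have "eigenvalue ?M z" using zh eigenvalue_mat_on_poly_iff[OF M] by blast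
  then show ?thesis using zh(1) by blast
qed

end

lemma exists_representation: "\<exists>bs M. represented_in scale bs u M"
proof -
  obtain bs where bs: "set bs = Basis" "distinct bs" using finite_distinct_list[OF finite_Basis] by blast
  define M where "M = mat (length bs) (length bs) (\<lambda>(i, j). representation Basis (u (bs ! j)) (bs ! i))"
  have "u (bs ! j) = (\<Sum>i<length bs. M $$ (i, j) *s bs ! i)" if j: "j < length bs" for j
  proof -
    have "u (bs ! j) = (\<Sum>b\<in>set bs. representation Basis (u (bs ! j)) b *s b)"
      using independent_Basis span_Basis finite_Basis bs by (intro sum_representation_eq[symmetric]) auto
    then show ?thesis using j unfolding sum_set_nth[OF bs(2)] by (simp add: M_def)
  qed
  then have "represented_in scale bs u M"
    using bs independent_Basis span_Basis by (simp add: represented_in_def ordered_basis_def M_def)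
  then show ?thesis by blast
qed

lemma eigenvalues_in_Root_iff:
  assumes r: "irreducible r"
  shows "(\<forall>z. ac_eigenvalue scale u z \<longrightarrow> z \<in> Root r) \<longleftrightarrow> (\<exists>N. annihilates scale (r ^ N) u)"
proof
  assume "\<exists>N. annihilates scale (r ^ N) u"
  then obtain N where N: "annihilates scale (r ^ N) u" by blast
  have "poly (map_poly to_ac (r ^ N)) z = 0" if "ac_eigenvalue scale u z" for z
    using that eigenvalue_root_of_annihilator[OF _ N] by (auto simp: ac_eigenvalue_def represented_by_def)
  moreover have "poly (map_poly to_ac (r ^ N)) z = poly (map_poly to_ac r) z ^ N" for z
    by (induction N) (simp_all add: to_ac_hom.hom_mult)
  ultimately show "\<forall>z. ac_eigenvalue scale u z \<longrightarrow> z \<in> Root r" by (auto simp: Root_def)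
next
  assume ev: "\<forall>z. ac_eigenvalue scale u z \<longrightarrow> z \<in> Root r"
  \<comment> \<open>An annihilator with as many factors \<open>r\<close> removed as possible: for
    \<open>h\<close> of least degree, \<open>r\<close> does not divide \<open>h\<close>. If no power
    of \<open>r\<close> annihilates \<open>u\<close>, then \<open>h\<close> kills a nonzero vector
    and shares a root with some eigenvalue; that root is also a root of \<open>r\<close>, against
    the Bezout identity.\<close>
  let ?P = "\<lambda>h. h \<noteq> 0 \<and> (\<exists>k. annihilates scale (r ^ k * h) u)"
  obtain m where "m \<noteq> 0" "annihilates scale m u" using exists_annihilating_poly by blast
  then have "?P m" by (auto intro: exI[of _ 0])
  then obtain h where h: "?P h" and min: "\<And>h'. ?P h' \<Longrightarrow> degree h \<le> degree h'"
    using ex_has_least_nat[of ?P m degree] by blast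
  obtain k where k: "annihilates scale (r ^ k * h) u" using h by blast
  have dr: "degree r > 0" using r by (rule irreducible_poly_degree_pos)
  show "\<exists>N. annihilates scale (r ^ N) u"
  proof (rule ccontr)
    assume no: "\<not> (\<exists>N. annihilates scale (r ^ N) u)"
    then obtain x where x: "act (r ^ k) x \<noteq> 0" by (auto simp: annihilates_def)
    have "act h (act (r ^ k) x) = 0" using k by (simp add: annihilates_def act_mult act_commute)
    moreover obtain bs M where rep: "represented_in scale bs u M" using exists_representation by blast
    ultimately obtain z where z: "poly (map_poly to_ac h) z = 0" "eigenvalue (map_mat to_ac M) z"
      using root_eigenvalue[OF rep] h x by blast
    then have rz: "poly (map_poly to_ac r) z = 0"
      using ev rep by (auto simp: ac_eigenvalue_def represented_by_def Root_def)
    have "\<not> r dvd h"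
    proof
      assume "r dvd h"
      then obtain h' where h': "h = r * h'" by (elim dvdE)
      have "annihilates scale (r ^ Suc k * h') u" using k by (simp add: h' mult.assoc mult.left_commute)
      then have "?P h'" using h h' by (intro conjI exI[of _ "Suc k"]) auto
      then have "degree h \<le> degree h'" by (rule min)
      moreover have "degree h = degree r + degree h'" using h unfolding h' by (subst degree_mult_eq) auto
      ultimately show False using dr by simp
    qed
    then obtain s t where "s * h + t * r = 1" using irreducible_poly_bezout[OF r] by blast
    then have "poly (map_poly to_ac (s * h + t * r)) z = 1" by simp
    then show False using z rz by (simp add: to_ac_hom.hom_add to_ac_hom.hom_mult)
  qed
qed

end

theorem theorem3p28:
  fixes scale :: "'a::field \<Rightarrow> 'b::ab_group_add \<Rightarrow> 'b"
    and Basis :: "'b set"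
    and p q r :: "'a poly"
    and u :: "'b \<Rightarrow> 'b"
  assumes "monic p" "degree p = 2" "irreducible p"
    and "monic q" "degree q = 2" "irreducible q"
    and "splitting_field p \<noteq> splitting_field q"
    and "discr p = discr q" "discr p \<noteq> 0"
    and "r = [:poly p 0 + poly q 0, poly_trace p, 1:]"
    and "finite_dimensional_vector_space scale Basis"
    and "endo scale u"
  shows "(pq_difference scale p q u \<and> d_exceptional scale p q u
      \<longleftrightarrow>
        (\<exists>n. minimal_poly scale u = r ^ n) \<and>
        (\<forall>k\<ge>1. invariant_factor scale u (2 * k - 1) = invariant_factor scale u (2 * k)))
    \<and>
      ((\<exists>n. minimal_poly scale u = r ^ n) \<and>
        (\<forall>k\<ge>1. invariant_factor scale u (2 * k - 1) = invariant_factor scale u (2 * k))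
      \<longleftrightarrow>
        (\<exists>Bs. (\<forall>B\<in>set Bs. \<exists>n>0. B = diag_block_mat [companion_mat (r ^ n), companion_mat (r ^ n)]) \<and>
          represented_by scale u (diag_block_mat Bs)))"
proof -
  interpret fin_dim_endo scale u Basis
    using assms(11,12)
    by (intro fin_dim_endo.intro endo_space.intro endo_space_axioms.intro)
      (simp_all add: finite_dimensional_vector_space_def)
  have pair: "char_2_pair p q r (coeff p 0) (coeff q 0) (coeff p 1)"
    using assms(1-10) by (rule char_2_pairI)
  interpret char_2_pair_endo scale u Basis p q r "coeff p 0" "coeff q 0" "coeff p 1"
    using fin_dim_endo_axioms pair by (rule char_2_pair_endo.intro)
  \<comment> \<open>All three conditions are compared with this one. Here
    \<open>2 * degree r\<close> is 4, the degree of the field acting on the socles.\<close>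
  let ?ev = "(\<exists>n. annihilates scale (r ^ n) u) \<and> (\<forall>j. 2 * degree r dvd socle_dim r j)"
  have ii: "(\<exists>n. minimal_poly scale u = r ^ n) \<and>
      (\<forall>k\<ge>1. invariant_factor scale u (2 * k - 1) = invariant_factor scale u (2 * k)) \<longleftrightarrow> ?ev"
    unfolding minimal_poly_eq_power_iff[OF irr(3) monic_r]
    by (rule conj_cong[OF refl], elim exE) (rule invariant_factors_paired_iff[OF irr(3) monic_r])
  have iii: "(\<exists>Bs. (\<forall>B\<in>set Bs. \<exists>n>0. B = diag_block_mat [companion_mat (r ^ n), companion_mat (r ^ n)]) \<and>
      represented_by scale u (diag_block_mat Bs)) \<longleftrightarrow> ?ev"
    unfolding represented_by_pairs_iff[OF irr(3) monic_r] by (rule paired_decomp_iff[OF irr(3) monic_r])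
  have exc: "d_exceptional scale p q u \<longleftrightarrow> (\<exists>n. annihilates scale (r ^ n) u)"
    unfolding d_exceptional_def Root_r[symmetric] by (rule eigenvalues_in_Root_iff[OF irr(3)])
  have "pq_difference scale p q u \<and> d_exceptional scale p q u \<longleftrightarrow> ?ev"
  proof
    assume "pq_difference scale p q u \<and> d_exceptional scale p q u"
    then show ?ev using pq_difference_socle_dim exc degree_r by simp
  next
    assume ev: ?ev
    then obtain m \<nu> vs where "cyclic_decomp UNIV (2 * m) (\<lambda>i. r ^ \<nu> (i div 2)) vs"
      using paired_decomp_iff[OF irr(3) monic_r] by blast
    then show "pq_difference scale p q u \<and> d_exceptional scale p q u"
      using paired_decomp_imp_pq_difference ev exc by blast
  qed
  with ii iii show ?thesis by blast
qed

end
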